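(* Let $\mathcal{D}$ be a circle with center $E$ and let $F\neq E$ be a point. Let $XY$ be the polar of $F$ with respect to $\mathcal{D}$ and let $L=EF\cap XY$. Let $\ell$ be a line containing $L$ (and not containing $F$). Denote by $\mathcal{P}$ the parabola with focus $F$ and directrix $\ell$. Then: (a) For any point $A$ of the circle $\mathcal{D}$ in the nonconvex connected component of the complement of $\mathcal{P}$, denote by $B$ and $D$ the intersections with the circle of the tangents through $A$ to the parabola. Then $L\in BD$. (b) For any point $A$ of the circle $\mathcal{D}$ in the nonconvex connected component of the complement of $\mathcal{P}$, there exists a quadrilateral $ABCD$ inscribed in the circle and circumscribed about the parabola. Thus, $(\mathcal{D},\mathcal{P})$ form a $4$-Poncelet pair. (c) For every Poncelet quadrilateral $ABCD$ associated with $(\mathcal{D},\mathcal{P})$, the intersection of the diagonals is $AC\cap BD=L$, and thus does not depend on the quadrilateral. (d) The points of intersection of the opposite sides of any Poncelet quadrilateral associated with $(\mathcal{D},\mathcal{P})$ lie on the line that contains $F$ and is orthogonal to $EF$. (e) The anticenters of the Poncelet quadrilaterals associated with $(\mathcal{D},\mathcal{P})$ lie on the directrix $\ell$. (f) The centroids of the Poncelet quadrilaterals associated with $(\mathcal{D},\mathcal{P})$ lie on a line $\ell'$ parallel to $\ell$. If $\ell$ is set to be parallel to the $y$-axis, with equation $x=-p$, and $F$ is at the origin, then the $x$-coordinate of the centroid $G$ is $$x_G=\frac{x_E-p}{2},$$ where $x_E$ is the $x$-coordinate of $E$.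
   Context: The complement of a parabola in the plane has two connected components, one convex (containing the focus) and one nonconvex. A quadrilateral $ABCD$ (possibly self-intersecting) is inscribed in $\mathcal{D}$ if its vertices lie on $\mathcal{D}$, and circumscribed about $\mathcal{P}$ if the lines $AB,BC,CD,DA$ containing its sides are tangent to $\mathcal{P}$. The pair $(\mathcal{D},\mathcal{P})$ is a $4$-Poncelet pair if there exists a quadrilateral inscribed in $\mathcal{D}$ and circumscribed about $\mathcal{P}$; such a quadrilateral is called a Poncelet quadrilateral associated with $(\mathcal{D},\mathcal{P})$. In (a), $B$ and $D$ are the intersections, other than $A$ itself, of the two tangents with the circle. "Intersection of opposite sides" refers to the lines containing the sides. The polar of $F$ with respect to the circle with center $E$ and radius $R$ is the line $\{X:(X-E)\cdot(F-E)=R^2\}$. For a cyclic quadrilateral, the four lines each passing through the midpoint of a side and orthogonal to the opposite side intersect at one point, called the anticenter. The centroid of $ABCD$ is the point $\tfrac14(A+B+C+D)$, which is the midpoint of the segment joining the circumcenter and the anticenter.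
   Formalization: In (b), a quadrilateral with four distinct vertices is claimed unless a tangent from A touches the circle at A, or B or D lies on the parabola; there only closure with multiplicities is claimed. The 4-Poncelet pair is claimed only when the circle meets the nonconvex component. *)

theory Defs
  imports "HOL-Analysis.Analysis"
begin

type_synonym plane = "real^2"

definition is_line :: "plane set \<Rightarrow> bool" where
  "is_line t \<longleftrightarrow> (\<exists>X Y. X \<noteq> Y \<and> t = affine hull {X, Y})"

definition perp_line :: "plane \<Rightarrow> plane \<Rightarrow> plane set" where
  "perp_line M v = {X. (X - M) \<bullet> v = 0}"

definition polar :: "plane \<Rightarrow> real \<Rightarrow> plane \<Rightarrow> plane set" where
  "polar E R F = {X. (X - E) \<bullet> (F - E) = R\<^sup>2}"

definition parabola :: "plane \<Rightarrow> plane set \<Rightarrow> plane set" where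
  "parabola F l = {X. dist X F = infdist X l}"

definition nonconvex_part :: "plane set \<Rightarrow> plane set" where
  "nonconvex_part P = \<Union> {K \<in> components (- P). \<not> convex K}"

text \<open>Tangency to a curve \<open>S\<close> at one of its points \<open>T\<close>, as the limiting position of
  secants: the distance from \<open>X \<in> S\<close> to the line is \<open>o(dist X T)\<close> as \<open>X\<close> tends to \<open>T\<close>
  along \<open>S\<close>. The limit point condition keeps this from being vacuous.\<close>

definition tangent_at :: "plane set \<Rightarrow> plane set \<Rightarrow> plane \<Rightarrow> bool" where
  "tangent_at t S T \<longleftrightarrow>
     is_line t \<and> T \<in> S \<and> T \<in> t \<and> T islimpt S \<and>
     ((\<lambda>X. infdist X t / dist X T) \<longlongrightarrow> 0) (at T within S)"

definition tangent_to :: "plane set \<Rightarrow> plane set \<Rightarrow> bool" where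
  "tangent_to t S \<longleftrightarrow> (\<exists>T. tangent_at t S T)"

definition inscribed :: "plane set \<Rightarrow> plane \<Rightarrow> plane \<Rightarrow> plane \<Rightarrow> plane \<Rightarrow> bool" where
  "inscribed S A B C D \<longleftrightarrow> A \<in> S \<and> B \<in> S \<and> C \<in> S \<and> D \<in> S"

definition circumscribed :: "plane set \<Rightarrow> plane \<Rightarrow> plane \<Rightarrow> plane \<Rightarrow> plane \<Rightarrow> bool" where
  "circumscribed P A B C D \<longleftrightarrow>
     tangent_to (affine hull {A, B}) P \<and> tangent_to (affine hull {B, C}) P \<and>
     tangent_to (affine hull {C, D}) P \<and> tangent_to (affine hull {D, A}) P"

text \<open>A quadrilateral has four distinct vertices; no convexity is required, so it may be
  self-intersecting. Without distinctness, \<open>A B A D\<close> would be circumscribed as soon as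
  \<open>AB\<close> and \<open>AD\<close> are tangent.\<close>

definition poncelet_quadrilateral ::
  "plane set \<Rightarrow> plane set \<Rightarrow> plane \<Rightarrow> plane \<Rightarrow> plane \<Rightarrow> plane \<Rightarrow> bool" where
  "poncelet_quadrilateral S P A B C D \<longleftrightarrow>
     distinct [A, B, C, D] \<and> inscribed S A B C D \<and> circumscribed P A B C D"

definition poncelet_pair4 :: "plane set \<Rightarrow> plane set \<Rightarrow> bool" where
  "poncelet_pair4 S P \<longleftrightarrow> (\<exists>A B C D. poncelet_quadrilateral S P A B C D)"

text \<open>For a circle \<open>S\<close> and \<open>X \<in> S\<close>, the points \<open>Y\<close> with \<open>second_intersection S t X Y\<close> are:
  the intersection of the line \<open>t\<close> with \<open>S\<close> other than \<open>X\<close> if there is one, and \<open>X\<close> itself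
  if \<open>t\<close> touches \<open>S\<close> at \<open>X\<close>.\<close>

definition second_intersection :: "plane set \<Rightarrow> plane set \<Rightarrow> plane \<Rightarrow> plane \<Rightarrow> bool" where
  "second_intersection S t X Y \<longleftrightarrow> t \<inter> S = {X, Y}"

text \<open>Closing of the Poncelet process after four steps, with the usual multiplicities. The two
  side lines at a vertex are the two tangents to \<open>P\<close> through it, so they differ unless the
  vertex is on \<open>P\<close>, where the two tangents coincide. A side line touching \<open>S\<close> gives equal
  consecutive vertices.\<close>

definition poncelet_closed4 ::
  "plane set \<Rightarrow> plane set \<Rightarrow> plane \<Rightarrow> plane \<Rightarrow> plane \<Rightarrow> plane \<Rightarrow> bool" where
  "poncelet_closed4 S P A B C D \<longleftrightarrow>
     (\<exists>a b c d. tangent_to a P \<and> tangent_to b P \<and> tangent_to c P \<and> tangent_to d P \<and>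
        second_intersection S a A B \<and> second_intersection S b B C \<and>
        second_intersection S c C D \<and> second_intersection S d D A \<and>
        (d \<noteq> a \<or> A \<in> P) \<and> (a \<noteq> b \<or> B \<in> P) \<and> (b \<noteq> c \<or> C \<in> P) \<and> (c \<noteq> d \<or> D \<in> P))"

definition anticenter :: "plane \<Rightarrow> plane \<Rightarrow> plane \<Rightarrow> plane \<Rightarrow> plane" where
  "anticenter A B C D =
     (THE H. perp_line (midpoint A B) (D - C) \<inter> perp_line (midpoint B C) (A - D) \<inter>
             perp_line (midpoint C D) (B - A) \<inter> perp_line (midpoint D A) (C - B) = {H})"

definition centroid :: "plane \<Rightarrow> plane \<Rightarrow> plane \<Rightarrow> plane \<Rightarrow> plane" where
  "centroid A B C D = (1 / 4) *\<^sub>R (A + B + C + D)"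

end

theory Submission
  imports Defs
begin

text \<open>Dualize about the focus \<open>F\<close>: a line \<open>{X. (X - F) \<bullet> w = 1}\<close> becomes the point \<open>w\<close>.
  The tangents of the parabola become a circle \<open>W\<close> through the origin, and the circle
  \<open>\<D>\<close> becomes a conic \<open>K\<close> with a focus at the origin. Since the directrix passes
  through \<open>L\<close>, the center of \<open>W\<close> lies on the minor axis of \<open>K\<close>, so \<open>W\<close> passes through both
  foci of \<open>K\<close>. Hence the two tangents of \<open>K\<close> from a point of \<open>W\<close> meet \<open>W\<close> again in points
  that are symmetric about the minor axis. Concretely, the lines \<open>w \<noteq> z\<close> of \<open>W\<close> meet on \<open>\<D>\<close>
  iff the product of their coordinates along the minor axis has a fixed value, which makes
  \<open>w, z', w', z\<close> a closed quadrilateral, where \<open>'\<close> is the reflection. That reflection is dual to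
  the harmonic homology with center \<open>L\<close> whose axis passes through \<open>F\<close> orthogonally to \<open>EF\<close>;
  it exchanges opposite vertices and opposite sides.\<close>

section \<open>Lines in the plane\<close>

definition rot :: "plane \<Rightarrow> plane" where
  "rot X = vector [- X$2, X$1]"

lemma inner_plane: "(X::plane) \<bullet> Y = X$1 * Y$1 + X$2 * Y$2"
  by (simp add: inner_vec_def sum_2)

lemma rot_nth [simp]: "rot X $ 1 = - X$2" "rot X $ 2 = X$1"
  by (simp_all add: rot_def vector_2)

lemma inner_rot [simp]:
  "X \<bullet> rot X = 0" "rot X \<bullet> X = 0" "rot X \<bullet> rot Y = X \<bullet> Y"
  by (simp_all add: inner_plane)

lemma rot_eq_0_iff [simp]: "rot X = 0 \<longleftrightarrow> X = 0"
  by (auto simp: vec_eq_iff forall_2)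

text \<open>Expansion in the orthogonal frame \<open>w\<close>, \<open>rot w\<close>, multiplied
  through by \<open>w \<bullet> w\<close> so that no division occurs.\<close>

lemma plane_decomp: "(w \<bullet> w) *\<^sub>R X = (X \<bullet> w) *\<^sub>R w + (X \<bullet> rot w) *\<^sub>R rot w"
  by (simp add: vec_eq_iff forall_2 inner_plane) (simp add: algebra_simps)

lemma orthogonal_imp_scaled_rot:
  assumes "w \<noteq> 0" "X \<bullet> w = 0"
  obtains s where "X = s *\<^sub>R rot w"
proof
  have "(w \<bullet> w) *\<^sub>R X = (X \<bullet> rot w) *\<^sub>R rot w"
    using plane_decomp[of w X] assms by simp
  then have "(1 / (w \<bullet> w)) *\<^sub>R ((w \<bullet> w) *\<^sub>R X) = ((X \<bullet> rot w) / (w \<bullet> w)) *\<^sub>R rot w"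
    by simp
  then show "X = ((X \<bullet> rot w) / (w \<bullet> w)) *\<^sub>R rot w"
    using assms(1) by simp
qed

lemma affine_hull_pair_eq_hyperplane:
  fixes A B :: plane
  assumes "A \<noteq> B" "A \<bullet> w = c" "B \<bullet> w = c" "w \<noteq> 0"
  shows "affine hull {A, B} = {X. X \<bullet> w = c}"
proof (intro equalityI subsetI)
  fix X assume "X \<in> affine hull {A, B}"
  then obtain a b where "X = a *\<^sub>R A + b *\<^sub>R B" "a + b = 1"
    unfolding affine_hull_2 by auto
  then show "X \<in> {X. X \<bullet> w = c}"
    using assms(2,3) by (simp add: inner_add_left distrib_right[symmetric])
next
  fix X assume X: "X \<in> {X. X \<bullet> w = c}"
  obtain s where s: "B - A = s *\<^sub>R rot w"
    using orthogonal_imp_scaled_rot[of w "B - A"] assms by (auto simp: inner_diff_left)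
  obtain r where r: "X - A = r *\<^sub>R rot w"
    using orthogonal_imp_scaled_rot[of w "X - A"] assms X by (auto simp: inner_diff_left)
  have "s \<noteq> 0" using s assms(1) by auto
  then have "X - A = (r / s) *\<^sub>R (B - A)" using r s by simp
  then have "X = (1 - r / s) *\<^sub>R A + (r / s) *\<^sub>R B" by (simp add: algebra_simps)
  then show "X \<in> affine hull {A, B}"
    unfolding affine_hull_2 by (intro CollectI exI[of _ "1 - r / s"] exI[of _ "r / s"]) simp
qed

lemma is_lineE:
  assumes "is_line t"
  obtains w c where "w \<noteq> 0" "t = {X. X \<bullet> w = c}"
proof -
  obtain A B where AB: "A \<noteq> B" "t = affine hull {A, B}" using assms by (auto simp: is_line_def)
  have "rot (B - A) \<noteq> 0" using AB(1) by simp
  moreover have "B \<bullet> rot (B - A) = A \<bullet> rot (B - A)" by (simp add: inner_plane algebra_simps)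
  ultimately show thesis
    using that affine_hull_pair_eq_hyperplane[OF AB(1), of "rot (B - A)"] AB(2) by metis
qed

lemma is_line_hyperplane:
  fixes w :: plane
  assumes "w \<noteq> 0"
  shows "is_line {X. X \<bullet> w = c}"
proof -
  let ?A = "(c / (w \<bullet> w)) *\<^sub>R w"
  have "?A \<noteq> ?A + rot w" using assms by simp
  moreover have "?A \<bullet> w = c" "(?A + rot w) \<bullet> w = c"
    using assms by (simp_all add: inner_add_left)
  ultimately show ?thesis
    using affine_hull_pair_eq_hyperplane assms unfolding is_line_def by metis
qed

lemma infdist_hyperplane:
  fixes w :: plane
  assumes "w \<noteq> 0"
  shows "infdist X {Y. Y \<bullet> w = c} = \<bar>X \<bullet> w - c\<bar> / norm w"
proof (rule antisym)
  \<comment> \<open>Foot of the perpendicular from \<open>X\<close>; it attains the Cauchy-Schwarz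
    lower bound.\<close>
  let ?Y = "X - ((X \<bullet> w - c) / (w \<bullet> w)) *\<^sub>R w"
  have "?Y \<bullet> w = c" using assms by (simp add: inner_diff_left)
  then have "infdist X {Y. Y \<bullet> w = c} \<le> dist X ?Y" by (intro infdist_le) simp
  also have "dist X ?Y = \<bar>X \<bullet> w - c\<bar> / norm w"
    using assms by (simp add: dist_norm dot_square_norm power2_eq_square)
  finally show "infdist X {Y. Y \<bullet> w = c} \<le> \<bar>X \<bullet> w - c\<bar> / norm w" .
  have "{Y. Y \<bullet> w = c} \<noteq> {}" using \<open>?Y \<bullet> w = c\<close> by blast
  moreover have "\<bar>X \<bullet> w - c\<bar> / norm w \<le> dist X Y" if "Y \<bullet> w = c" for Y
    using Cauchy_Schwarz_ineq2[of "X - Y" w] that assms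
    by (simp add: inner_diff_left dist_norm divide_le_eq)
  ultimately show "\<bar>X \<bullet> w - c\<bar> / norm w \<le> infdist X {Y. Y \<bullet> w = c}"
    unfolding infdist_def by (auto intro!: cINF_greatest)
qed

text \<open>At parameter \<open>s\<close> on the line, the squared distance from \<open>Z\<close>
  exceeds \<open>r\<^sup>2\<close> by \<open>s * (s - 1) * ((B - A) \<bullet> (B - A))\<close>,
  which vanishes only at the two ends of the chord.\<close>

lemma sphere_line_at_most_two:
  fixes A B C :: plane
  assumes "A \<in> sphere Z r" "B \<in> sphere Z r" "C \<in> sphere Z r"
    and "w \<noteq> 0" "A \<bullet> w = c" "B \<bullet> w = c" "C \<bullet> w = c" "A \<noteq> B"
  shows "C = A \<or> C = B"
proof -
  have "C \<in> affine hull {A, B}"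
    using affine_hull_pair_eq_hyperplane[of A B w c] assms by simp
  then obtain k s where ks: "C = k *\<^sub>R A + s *\<^sub>R B" "k + s = 1"
    unfolding affine_hull_2 by auto
  have "k = 1 - s" using ks(2) by simp
  then have C: "C = A + s *\<^sub>R (B - A)"
    using ks(1) by (simp add: scaleR_left_diff_distrib scaleR_right_diff_distrib)
  have sq: "(A - Z) \<bullet> (A - Z) = r\<^sup>2" "(B - Z) \<bullet> (B - Z) = r\<^sup>2" "(C - Z) \<bullet> (C - Z) = r\<^sup>2"
    using assms(1-3) by (auto simp: dot_square_norm dist_norm norm_minus_commute)
  have "(C - Z) \<bullet> (C - Z) = (1 - s) * ((A - Z) \<bullet> (A - Z)) + s * ((B - Z) \<bullet> (B - Z))
      + s * (s - 1) * ((B - A) \<bullet> (B - A))"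
    unfolding C by (simp add: inner_plane algebra_simps)
  then have "s * (s - 1) * ((B - A) \<bullet> (B - A)) = 0" unfolding sq by (simp add: algebra_simps)
  then have "s = 0 \<or> s = 1" using assms(8) by auto
  then show ?thesis using C by auto
qed

section \<open>Tangents of a parabola\<close>

text \<open>Polarity in the unit circle about \<open>F\<close>. Each line missing \<open>F\<close>
  comes from exactly one nonzero \<open>w\<close>; the value \<open>w = 0\<close> gives the empty
  set, so any member forces \<open>w \<noteq> 0\<close>.\<close>

definition dual_line :: "plane \<Rightarrow> plane \<Rightarrow> plane set" where
  "dual_line F w = {X. (X - F) \<bullet> w = 1}"

lemma dual_line_eq_hyperplane: "dual_line F w = {X. X \<bullet> w = 1 + F \<bullet> w}"
  by (auto simp: dual_line_def inner_diff_left)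

lemma dual_line_nonzero: "X \<in> dual_line F w \<Longrightarrow> w \<noteq> 0"
  by (auto simp: dual_line_def)

lemma dual_line_inject:
  assumes "w \<noteq> 0" "dual_line F w = dual_line F v"
  shows "w = v"
proof -
  \<comment> \<open>\<open>F + Y\<close> is the foot of the perpendicular from \<open>F\<close>;
    this point and its translate by \<open>rot w\<close> determine \<open>v\<close>.\<close>
  define Y where "Y = (1 / (w \<bullet> w)) *\<^sub>R w"
  have "F + Y \<in> dual_line F w" "F + (Y + rot w) \<in> dual_line F w"
    using assms(1) by (simp_all add: dual_line_def Y_def inner_add_left)
  then have Y: "Y \<bullet> v = 1" "(Y + rot w) \<bullet> v = 1"
    unfolding assms(2) by (simp_all add: dual_line_def)
  then have "rot w \<bullet> v = 0" by (simp add: inner_add_left)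
  moreover have "w \<bullet> v = w \<bullet> w" using Y(1) assms(1) by (auto simp: Y_def divide_eq_1_iff)
  ultimately have "v \<bullet> w = w \<bullet> w" "v \<bullet> rot w = 0" by (simp_all add: inner_commute)
  then have "(w \<bullet> w) *\<^sub>R v = (w \<bullet> w) *\<^sub>R w"
    using plane_decomp[of w v] by simp
  then show ?thesis using assms(1) by simp
qed

lemma affine_hull_eq_dual_line:
  assumes "A \<noteq> B" "A \<in> dual_line F w" "B \<in> dual_line F w"
  shows "affine hull {A, B} = dual_line F w"
  using affine_hull_pair_eq_hyperplane[OF assms(1)] assms(2,3) dual_line_nonzero[OF assms(2)]
  unfolding dual_line_eq_hyperplane by blast

lemma is_line_dual_lineE:
  assumes "is_line t" "F \<notin> t"
  obtains w where "w \<noteq> 0" "t = dual_line F w"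
proof -
  obtain n c where n: "n \<noteq> 0" "t = {X. X \<bullet> n = c}" using is_lineE[OF assms(1)] .
  let ?d = "c - F \<bullet> n"
  have d: "?d \<noteq> 0" using assms(2) n(2) by auto
  have "t = dual_line F ((1 / ?d) *\<^sub>R n)"
    using d n by (auto simp: dual_line_def inner_diff_left)
  then show thesis using that[of "(1 / ?d) *\<^sub>R n"] d n(1) by simp
qed

lemma inner_self_decomp:
  fixes w :: plane
  shows "(w \<bullet> w) * (X \<bullet> Y) = (X \<bullet> w) * (Y \<bullet> w) + (X \<bullet> rot w) * (Y \<bullet> rot w)"
  by (simp add: inner_plane algebra_simps)

text \<open>Squaring the focus-directrix condition and expanding the norm in the frame
  \<open>g\<close>, \<open>rot g\<close> cancels the square of the coordinate along
  \<open>g\<close>.\<close>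

lemma mem_parabola_iff:
  assumes "g \<noteq> 0"
  shows "X \<in> parabola F (dual_line F g) \<longleftrightarrow> ((X - F) \<bullet> rot g)\<^sup>2 = 1 - 2 * ((X - F) \<bullet> g)"
proof -
  let ?Y = "X - F"
  have "X \<in> parabola F (dual_line F g) \<longleftrightarrow> norm ?Y = \<bar>?Y \<bullet> g - 1\<bar> / norm g"
    unfolding parabola_def dual_line_eq_hyperplane
    by (simp add: infdist_hyperplane[OF assms] dist_norm inner_diff_left diff_diff_eq2 algebra_simps)
  also have "\<dots> \<longleftrightarrow> norm g * norm ?Y = \<bar>?Y \<bullet> g - 1\<bar>"
    using assms by (simp add: eq_divide_eq mult.commute)
  also have "\<dots> \<longleftrightarrow> (norm g * norm ?Y)\<^sup>2 = \<bar>?Y \<bullet> g - 1\<bar>\<^sup>2"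
    by (metis abs_ge_zero mult_nonneg_nonneg norm_ge_zero power2_eq_imp_eq)
  also have "\<dots> \<longleftrightarrow> (g \<bullet> g) * (?Y \<bullet> ?Y) = (?Y \<bullet> g - 1)\<^sup>2"
    by (simp add: power_mult_distrib power2_norm_eq_inner)
  also have "\<dots> \<longleftrightarrow> (?Y \<bullet> rot g)\<^sup>2 = 1 - 2 * (?Y \<bullet> g)"
    unfolding inner_self_decomp[of g ?Y ?Y] by (auto simp: power2_eq_square algebra_simps)
  finally show ?thesis .
qed

text \<open>Writing \<open>a = (X - F) \<bullet> g\<close> and \<open>b = (X - F) \<bullet> rot g\<close>, the parabola is the graph
  \<open>a = (1 - b\<^sup>2) / 2\<close>, so that differences of its points are divisible by the difference of
  their \<open>b\<close>-coordinates.\<close>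

lemma parabola_chord:
  assumes g: "g \<noteq> 0"
    and X: "X \<in> parabola F (dual_line F g)" and T: "T \<in> parabola F (dual_line F g)"
  defines "b \<equiv> (X - F) \<bullet> rot g" and "b0 \<equiv> (T - F) \<bullet> rot g"
  shows "X - T = ((b - b0) / (g \<bullet> g)) *\<^sub>R (rot g - ((b + b0) / 2) *\<^sub>R g)"
proof -
  have a: "(X - F) \<bullet> g = (1 - b\<^sup>2) / 2" "(T - F) \<bullet> g = (1 - b0\<^sup>2) / 2"
    using X T mem_parabola_iff[OF g] by (simp_all add: b_def b0_def)
  have ab: "(X - T) \<bullet> g = - ((b - b0) * (b + b0) / 2)" "(X - T) \<bullet> rot g = b - b0"
    using a by (simp_all add: inner_diff_left b_def b0_def power2_eq_square field_simps)
  have "(g \<bullet> g) *\<^sub>R (X - T) = (b - b0) *\<^sub>R (rot g - ((b + b0) / 2) *\<^sub>R g)"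
    unfolding plane_decomp ab by (simp add: scaleR_right_diff_distrib)
  then have "(1 / (g \<bullet> g)) *\<^sub>R ((g \<bullet> g) *\<^sub>R (X - T))
      = (1 / (g \<bullet> g)) *\<^sub>R ((b - b0) *\<^sub>R (rot g - ((b + b0) / 2) *\<^sub>R g))"
    by (rule arg_cong)
  then show ?thesis using g by simp
qed

text \<open>Supplies the limit point condition of tangency and makes limits along the parabola
  unique.\<close>

lemma islimpt_parabola:
  assumes g: "g \<noteq> 0" and T: "T \<in> parabola F (dual_line F g)"
  shows "T islimpt parabola F (dual_line F g)"
proof -
  let ?P = "parabola F (dual_line F g)"
  \<comment> \<open>Parametrization by the coordinate \<open>b\<close> along the directrix; it is
    continuous and injective, so it reaches \<open>T\<close> through other points of the
    curve.\<close>
  define \<gamma> where "\<gamma> b = F + (1 / (g \<bullet> g)) *\<^sub>R (((1 - b\<^sup>2) / 2) *\<^sub>R g + b *\<^sub>R rot g)" for b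
  have \<gamma>: "(\<gamma> b - F) \<bullet> rot g = b" "(\<gamma> b - F) \<bullet> g = (1 - b\<^sup>2) / 2" for b
    using g by (simp_all add: \<gamma>_def inner_add_left)
  have \<gamma>P: "\<gamma> b \<in> ?P" for b
    unfolding mem_parabola_iff[OF g] \<gamma> by (simp add: field_simps)
  define b0 where "b0 = (T - F) \<bullet> rot g"
  have T0: "\<gamma> b0 = T"
    using parabola_chord[OF g \<gamma>P T, of b0] by (simp add: \<gamma> b0_def)
  have "continuous_on UNIV \<gamma>" unfolding \<gamma>_def by (intro continuous_intros) auto
  then have "(\<gamma> \<longlongrightarrow> T) (at b0)"
    using T0 by (metis UNIV_I continuous_on_def)
  moreover have "eventually (\<lambda>b. \<gamma> b \<noteq> T) (at b0)"
  proof -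
    have "\<gamma> b \<noteq> T" if "b \<noteq> b0" for b using \<gamma>(1)[of b] that unfolding b0_def by metis
    then show ?thesis by (simp add: eventually_at_filter)
  qed
  ultimately have lim: "filterlim \<gamma> (at T) (at b0)"
    by (simp add: filterlim_at)
  show ?thesis
    unfolding islimpt_iff_eventually
  proof
    assume "\<forall>\<^sub>F y in at T. y \<notin> ?P"
    then have "\<forall>\<^sub>F b in at b0. \<gamma> b \<notin> ?P" using lim by (rule eventually_compose_filterlim)
    then show False using \<gamma>P by simp
  qed
qed

text \<open>The quotient in the definition of tangency is the absolute cosine between the secant
  direction and \<open>n\<close>. The secant direction tends to \<open>rot g - b0 g\<close>, so the
  limit is zero exactly when \<open>n\<close> is orthogonal to that vector.\<close>

lemma tangent_at_parabola_iff:
  assumes g: "g \<noteq> 0" and T: "T \<in> parabola F (dual_line F g)" and n: "n \<noteq> 0"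
  shows "tangent_at {X. X \<bullet> n = T \<bullet> n} (parabola F (dual_line F g)) T
    \<longleftrightarrow> n \<bullet> rot g = ((T - F) \<bullet> rot g) * (n \<bullet> g)"
proof -
  let ?P = "parabola F (dual_line F g)"
  define b0 where "b0 = (T - F) \<bullet> rot g"
  define D where "D X = rot g - (((X - F) \<bullet> rot g + b0) / 2) *\<^sub>R g" for X
  define \<phi> where "\<phi> X = \<bar>D X \<bullet> n\<bar> / (norm n * norm (D X))" for X
  \<comment> \<open>The constant component along \<open>rot g\<close> keeps \<open>D\<close> away
    from zero, also at \<open>T\<close>, so \<open>\<phi>\<close> is continuous there.\<close>
  have "D X \<bullet> rot g = g \<bullet> g" for X by (simp add: D_def inner_diff_left)
  then have D0: "D X \<noteq> 0" for X using g by (metis inner_eq_zero_iff inner_zero_left)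
  have ratio: "infdist X {X. X \<bullet> n = T \<bullet> n} / dist X T = \<phi> X" if "X \<in> ?P" "X \<noteq> T" for X
  proof -
    define c where "c = ((X - F) \<bullet> rot g - b0) / (g \<bullet> g)"
    have XT: "X - T = c *\<^sub>R D X"
      using parabola_chord[OF g that(1) T] by (simp add: c_def D_def b0_def)
    then have "c \<noteq> 0" using that(2) by auto
    have "infdist X {X. X \<bullet> n = T \<bullet> n} / dist X T = \<bar>(X - T) \<bullet> n\<bar> / norm n / norm (X - T)"
      by (simp add: infdist_hyperplane[OF n] dist_norm inner_diff_left)
    also have "\<dots> = \<phi> X"
      unfolding XT \<phi>_def using \<open>c \<noteq> 0\<close> by (simp add: abs_mult)
    finally show ?thesis .
  qed
  have "continuous_on UNIV \<phi>"
    unfolding \<phi>_def using D0 n by (auto simp: D_def intro!: continuous_intros)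
  then have "(\<phi> \<longlongrightarrow> \<phi> T) (at T)" by (metis UNIV_I continuous_on_def)
  then have "(\<phi> \<longlongrightarrow> \<phi> T) (at T within ?P)"
    using tendsto_within_subset subset_UNIV by blast
  then have lim: "((\<lambda>X. infdist X {X. X \<bullet> n = T \<bullet> n} / dist X T) \<longlongrightarrow> \<phi> T) (at T within ?P)"
    by (rule tendsto_cong[THEN iffD1, rotated]) (auto simp: eventually_at_filter ratio)
  have limpt: "T islimpt ?P" using islimpt_parabola[OF g T] .
  then have "at T within ?P \<noteq> bot" by (simp add: trivial_limit_within)
  note lim_unique = tendsto_unique[OF this lim]
  have "((\<lambda>X. infdist X {X. X \<bullet> n = T \<bullet> n} / dist X T) \<longlongrightarrow> 0) (at T within ?P) \<longleftrightarrow> \<phi> T = 0"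
    (is "?L \<longleftrightarrow> _")
  proof
    show "\<phi> T = 0" if ?L using lim_unique[OF that] .
    show ?L if "\<phi> T = 0" using lim unfolding that .
  qed
  also have "\<dots> \<longleftrightarrow> D T \<bullet> n = 0" using D0 n by (simp add: \<phi>_def)
  also have "\<dots> \<longleftrightarrow> n \<bullet> rot g = b0 * (n \<bullet> g)"
    unfolding D_def b0_def inner_commute[of _ n] by (simp add: inner_diff_right)
  finally show ?thesis
    using T limpt is_line_hyperplane[OF n] unfolding tangent_at_def b0_def by simp
qed

text \<open>This is the contact point of \<open>dual_line F w\<close>: its dual is the tangent at
  \<open>w\<close> to the circle with center \<open>g\<close> through the origin.\<close>

lemma touching_point_mem_parabola:
  assumes g: "g \<noteq> 0" and w: "w \<noteq> 0" "w \<bullet> w = 2 * (g \<bullet> w)"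
  shows "F + (1 / (g \<bullet> w)) *\<^sub>R (w - g) \<in> parabola F (dual_line F g)"
proof -
  have gw: "g \<bullet> w \<noteq> 0" using w by auto
  have "(w \<bullet> rot g)\<^sup>2 = 2 * (g \<bullet> w) * (g \<bullet> g) - (g \<bullet> w)\<^sup>2"
    using inner_self_decomp[of g w w] w(2) by (simp add: power2_eq_square inner_commute algebra_simps)
  moreover have "(w - g) \<bullet> rot g = w \<bullet> rot g" "(w - g) \<bullet> g = g \<bullet> w - g \<bullet> g"
    by (simp_all add: inner_diff_left inner_commute[of w g])
  ultimately show ?thesis
    unfolding mem_parabola_iff[OF g] using gw
    by (simp add: power_divide) (simp add: field_simps power2_eq_square)
qed

text \<open>The lines \<open>dual_line F w\<close> with \<open>w \<noteq> 0\<close> on the circle \<open>w \<bullet> w = 2 * (g \<bullet> w)\<close> are the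
  perpendicular bisectors of the segments joining \<open>F\<close> to the points of the directrix.\<close>

lemma tangent_to_parabola_iff:
  assumes g: "g \<noteq> 0"
  shows "tangent_to t (parabola F (dual_line F g))
    \<longleftrightarrow> (\<exists>w. w \<noteq> 0 \<and> w \<bullet> w = 2 * (g \<bullet> w) \<and> t = dual_line F w)"
proof
  assume "tangent_to t (parabola F (dual_line F g))"
  then obtain T where tan: "tangent_at t (parabola F (dual_line F g)) T"
    by (auto simp: tangent_to_def)
  then have T: "T \<in> parabola F (dual_line F g)" "is_line t" "T \<in> t" by (auto simp: tangent_at_def)
  obtain n c where "n \<noteq> 0" "t = {X. X \<bullet> n = c}" using is_lineE[OF T(2)] .
  then have n: "n \<noteq> 0" "t = {X. X \<bullet> n = T \<bullet> n}" using T(3) by auto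
  define b0 where "b0 = (T - F) \<bullet> rot g"
  have nb: "n \<bullet> rot g = b0 * (n \<bullet> g)"
    using tan tangent_at_parabola_iff[OF g T(1) n(1)] n(2) by (simp add: b0_def)
  define d where "d = g + b0 *\<^sub>R rot g"
  have nd: "(g \<bullet> g) *\<^sub>R n = (n \<bullet> g) *\<^sub>R d"
    unfolding plane_decomp nb d_def by (simp add: algebra_simps)
  then have ng: "n \<bullet> g \<noteq> 0" using n(1) g by auto
  have b0: "1 + b0\<^sup>2 > 0" by (smt (verit) zero_le_power2)
  have Td: "(T - F) \<bullet> d = (1 + b0\<^sup>2) / 2"
  proof -
    have "b0\<^sup>2 = 1 - 2 * ((T - F) \<bullet> g)"
      using T(1) mem_parabola_iff[OF g, of T] by (simp add: b0_def)
    moreover have "(T - F) \<bullet> d = (T - F) \<bullet> g + b0\<^sup>2"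
      by (simp add: d_def inner_add_right power2_eq_square b0_def[symmetric])
    ultimately show ?thesis by simp
  qed
  \<comment> \<open>By \<open>Td\<close>, this multiple of the normal direction \<open>d\<close>
    satisfies \<open>(T - F) \<bullet> w = 1\<close>.\<close>
  define w where "w = (2 / (1 + b0\<^sup>2)) *\<^sub>R d"
  have "X \<in> t \<longleftrightarrow> X \<in> dual_line F w" for X
  proof -
    have "X \<in> t \<longleftrightarrow> (X - T) \<bullet> ((g \<bullet> g) *\<^sub>R n) = 0" using n g by (simp add: inner_diff_left)
    also have "\<dots> \<longleftrightarrow> (X - T) \<bullet> d = 0" unfolding nd using ng by simp
    also have "\<dots> \<longleftrightarrow> (X - F) \<bullet> d = (1 + b0\<^sup>2) / 2"
      unfolding Td[symmetric] by (simp add: inner_diff_left)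
    also have "\<dots> \<longleftrightarrow> X \<in> dual_line F w"
      using b0 by (auto simp: dual_line_def w_def field_simps)
    finally show ?thesis .
  qed
  then have t: "t = dual_line F w" by blast
  have dd: "d \<bullet> d = (1 + b0\<^sup>2) * (g \<bullet> g)" "g \<bullet> d = g \<bullet> g"
    by (simp_all add: d_def inner_add_left inner_add_right power2_eq_square algebra_simps)
  have "w \<bullet> w = 2 * (g \<bullet> w)"
    using b0 by (simp add: w_def dd)
  moreover have "w \<noteq> 0" using dual_line_nonzero T(3) t by blast
  ultimately show "\<exists>w. w \<noteq> 0 \<and> w \<bullet> w = 2 * (g \<bullet> w) \<and> t = dual_line F w" using t by blast
next
  assume "\<exists>w. w \<noteq> 0 \<and> w \<bullet> w = 2 * (g \<bullet> w) \<and> t = dual_line F w"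
  then obtain w where w: "w \<noteq> 0" "w \<bullet> w = 2 * (g \<bullet> w)" "t = dual_line F w" by blast
  have gw: "g \<bullet> w \<noteq> 0" using w by auto
  define T where "T = F + (1 / (g \<bullet> w)) *\<^sub>R (w - g)"
  have T: "T \<in> parabola F (dual_line F g)"
    using touching_point_mem_parabola[OF g w(1,2)] by (simp add: T_def)
  have "T \<bullet> w = 1 + F \<bullet> w"
    using gw w(2) by (simp add: T_def inner_add_left inner_diff_left)
  then have t: "t = {X. X \<bullet> w = T \<bullet> w}" using w(3) by (simp add: dual_line_eq_hyperplane)
  have "w \<bullet> rot g = ((T - F) \<bullet> rot g) * (w \<bullet> g)"
    using gw by (simp add: T_def inner_diff_left inner_commute[of w g])
  then show "tangent_to t (parabola F (dual_line F g))"
    using tangent_at_parabola_iff[OF g T w(1)] t by (auto simp: tangent_to_def)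
qed

section \<open>The outer component and its two tangents\<close>

text \<open>The inner region \<open>f < 1\<close> is convex, hence connected, hence a whole
  component; a nonconvex component must therefore lie in \<open>f > 1\<close>.\<close>

lemma nonconvex_part_parabola:
  assumes g: "g \<noteq> 0" and A: "A \<in> nonconvex_part (parabola F (dual_line F g))"
  shows "((A - F) \<bullet> rot g)\<^sup>2 > 1 - 2 * ((A - F) \<bullet> g)"
proof (rule ccontr)
  assume not: "\<not> ?thesis"
  define f where "f X = ((X - F) \<bullet> rot g)\<^sup>2 + 2 * ((X - F) \<bullet> g)" for X
  define U where "U = {X. f X < 1}"
  define V where "V = {X. f X > 1}"
  have P: "X \<in> parabola F (dual_line F g) \<longleftrightarrow> f X = 1" for X
    by (auto simp: mem_parabola_iff[OF g] f_def)
  obtain K where K: "K \<in> components (- parabola F (dual_line F g))" "\<not> convex K" "A \<in> K"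
    using A by (auto simp: nonconvex_part_def)
  have "K \<subseteq> - parabola F (dual_line F g)" using K(1) in_components_subset by blast
  then have "K \<subseteq> U \<union> V" using P by (fastforce simp: U_def V_def)
  have "A \<in> U" using not K(3) \<open>K \<subseteq> U \<union> V\<close> by (auto simp: U_def V_def f_def)
  have "continuous_on UNIV f" unfolding f_def by (intro continuous_intros)
  then have "open U" "open V"
    unfolding U_def V_def by (auto intro!: open_Collect_less continuous_intros)
  moreover have "connected K" using K(1) in_components_connected by blast
  moreover have "U \<inter> V \<inter> K = {}" by (auto simp: U_def V_def)
  ultimately have "K \<inter> V = {}"
    using \<open>K \<subseteq> U \<union> V\<close> \<open>A \<in> U\<close> K(3) connectedD[of K U V] by blast
  then have "K \<subseteq> U" using \<open>K \<subseteq> U \<union> V\<close> by blast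
  have "convex U"
  proof (rule convexI)
    fix X Y and s t :: real
    assume XY: "X \<in> U" "Y \<in> U" and st: "s \<ge> 0" "t \<ge> 0" "s + t = 1"
    have s: "s = 1 - t" using st by simp
    have "f (s *\<^sub>R X + t *\<^sub>R Y) = s * f X + t * f Y - s * t * ((X - Y) \<bullet> rot g)\<^sup>2"
      unfolding s f_def by (simp add: inner_add_left inner_diff_left power2_eq_square algebra_simps)
    moreover have "s * t * ((X - Y) \<bullet> rot g)\<^sup>2 \<ge> 0" using st by simp
    moreover have "s * f X + t * f Y < 1"
      using convex_bound_lt[of "f X" 1 "f Y" s t] XY st by (simp add: U_def)
    ultimately show "s *\<^sub>R X + t *\<^sub>R Y \<in> U" by (simp add: U_def)
  qed
  have "U \<subseteq> - parabola F (dual_line F g)" using P by (auto simp: U_def)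
  then have "U \<subseteq> K"
    using components_maximal[OF K(1) convex_connected[OF \<open>convex U\<close>]] \<open>A \<in> U\<close> K(3) by blast
  then show False using \<open>K \<subseteq> U\<close> \<open>convex U\<close> K(2) by auto
qed

text \<open>The tangent whose contact point has coordinate \<open>\<beta>\<close> along
  \<open>rot g\<close> passes through \<open>A\<close> when \<open>\<beta>\<close> solves a
  quadratic. Its quarter discriminant \<open>b\<^sup>2 + 2 * a - 1\<close> is positive outside the
  parabola, which gives the roots \<open>b + r\<close> and \<open>b - r\<close>.\<close>

lemma nonconvex_part_two_tangents:
  assumes g: "g \<noteq> 0" and A: "A \<in> nonconvex_part (parabola F (dual_line F g))"
  obtains w z where "w \<noteq> z" "w \<bullet> w = 2 * (g \<bullet> w)" "z \<bullet> z = 2 * (g \<bullet> z)"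
    "A \<in> dual_line F w" "A \<in> dual_line F z"
proof -
  define a b where "a = (A - F) \<bullet> g" and "b = (A - F) \<bullet> rot g"
  define r where "r = sqrt (b\<^sup>2 + 2 * a - 1)"
  have pos: "b\<^sup>2 + 2 * a - 1 > 0"
    using nonconvex_part_parabola[OF assms] by (simp add: a_def b_def)
  then have r: "r > 0" "r\<^sup>2 = b\<^sup>2 + 2 * a - 1" by (simp_all add: r_def)
  define d where "d \<beta> = g + \<beta> *\<^sub>R rot g" for \<beta>
  define W where "W \<beta> = (2 / (1 + \<beta>\<^sup>2)) *\<^sub>R d \<beta>" for \<beta>
  have p: "1 + \<beta>\<^sup>2 > 0" for \<beta> :: real by (smt (verit) zero_le_power2)
  have gg: "g \<bullet> g > 0" using g by simp
  have d: "d \<beta> \<bullet> g = g \<bullet> g" "g \<bullet> d \<beta> = g \<bullet> g" "d \<beta> \<bullet> rot g = \<beta> * (g \<bullet> g)"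
      "d \<beta> \<bullet> d \<beta> = (1 + \<beta>\<^sup>2) * (g \<bullet> g)" "(A - F) \<bullet> d \<beta> = a + \<beta> * b" for \<beta>
    by (simp_all add: d_def a_def b_def inner_add_left inner_add_right power2_eq_square algebra_simps)
  have Wg: "W \<beta> \<bullet> g = 2 / (1 + \<beta>\<^sup>2) * (g \<bullet> g)" "W \<beta> \<bullet> rot g = \<beta> * (W \<beta> \<bullet> g)" for \<beta>
    by (simp_all add: W_def d)
  have WW: "W \<beta> \<bullet> W \<beta> = 2 * (g \<bullet> W \<beta>)" for \<beta>
    using p[of \<beta>] by (simp add: W_def d)
  have mem: "A \<in> dual_line F (W \<beta>)" if "\<beta>\<^sup>2 - 2 * b * \<beta> + 1 - 2 * a = 0" for \<beta>
  proof -
    have "2 * (a + \<beta> * b) = 1 + \<beta>\<^sup>2" using that by (simp add: algebra_simps)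
    then show ?thesis using p[of \<beta>] by (simp add: dual_line_def W_def d)
  qed
  \<comment> \<open>The quotient of the two components of \<open>W \<beta>\<close> in the frame
    \<open>g\<close>, \<open>rot g\<close> recovers \<open>\<beta>\<close>.\<close>
  have "W (b + r) \<noteq> W (b - r)"
  proof
    assume eq: "W (b + r) = W (b - r)"
    have "W (b + r) \<bullet> g \<noteq> 0" using Wg(1) gg p[of "b + r"] by simp
    then show False using Wg(2)[of "b + r"] Wg(2)[of "b - r"] r eq by simp
  qed
  moreover have "(b + r)\<^sup>2 - 2 * b * (b + r) + 1 - 2 * a = 0"
      "(b - r)\<^sup>2 - 2 * b * (b - r) + 1 - 2 * a = 0"
    using r(2) by (simp_all add: power2_eq_square algebra_simps)
  ultimately show thesis using that WW mem by blast
qed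

section \<open>Products of two bounded factors\<close>

text \<open>One factor is taken just above \<open>sqrt c\<close>, so that its partner falls below
  \<open>sqrt c\<close>.\<close>

lemma ex_unequal_factors:
  fixes c s :: real
  assumes "0 < c" "c < s\<^sup>2" "0 < s"
  obtains a b where "0 < a" "a < s" "0 < b" "b < s" "a * b = c" "a \<noteq> b"
proof -
  have s: "0 < sqrt c" "sqrt c < s" using assms real_less_lsqrt[of s c] by auto
  then obtain a where a: "sqrt c < a" "a < s" using dense by blast
  have "0 < a" using s(1) a(1) by linarith
  have "c = sqrt c * sqrt c" using assms(1) by simp
  also have "\<dots> < sqrt c * a" using mult_strict_left_mono[OF a(1) s(1)] .
  finally have "c / a < sqrt c" using \<open>0 < a\<close> by (simp add: divide_less_eq)
  then show thesis using that[of a "c / a"] a s \<open>0 < a\<close> assms by auto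
qed

lemma mult_less_square:
  fixes a b s :: real
  assumes "0 < a" "a \<le> s" "0 < b" "b \<le> s" "a = b \<Longrightarrow> a < s"
  shows "a * b < s\<^sup>2"
proof (cases "a < s")
  case True
  have "a * b \<le> a * s" using assms by simp
  also have "\<dots> < s * s" using assms True by simp
  finally show ?thesis by (simp add: power2_eq_square)
next
  case False
  then have "a = s" using assms(2) by simp
  moreover from this have "b < s" using assms(4,5) False by (cases "b = s") auto
  ultimately show ?thesis using assms(1) by (simp add: power2_eq_square)
qed

section \<open>The dual circle\<close>

text \<open>With \<open>d = dist E F\<close> and \<open>\<kappa> = d\<^sup>2 - R\<^sup>2\<close>, the parameters are \<open>u = (E - F) / d\<close>, \<open>q = d / \<kappa>\<close> and
  \<open>\<mu> = 1 / \<kappa>\<close>, so that \<open>E = F + (q / \<mu>) u\<close> and \<open>L = F + (1 / q) u\<close>. The directrix is dual to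
  \<open>g = q u + h rot u\<close>, and \<open>h\<close> selects it among the lines through \<open>L\<close>.\<close>

locale focal_circle =
  fixes F u :: plane and q h \<mu> R :: real
  assumes u: "u \<bullet> u = 1" and q: "q \<noteq> 0" and \<mu>: "\<mu> \<noteq> 0" and R: "R > 0"
    and R2: "R\<^sup>2 = (q / \<mu>)\<^sup>2 - 1 / \<mu>"
begin

definition g :: plane where "g = q *\<^sub>R u + h *\<^sub>R rot u"
definition P :: "plane set" where "P = parabola F (dual_line F g)"
definition S :: "plane set" where "S = sphere (F + (q / \<mu>) *\<^sub>R u) R"
definition L :: plane where "L = F + (1 / q) *\<^sub>R u"
text \<open>The duals of the tangents of \<open>P\<close>. The origin lies on this circle but is
  dual to no line.\<close>

definition W :: "plane set" where "W = {w. w \<noteq> 0 \<and> w \<bullet> w = 2 * (g \<bullet> w)}"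
text \<open>Records all tangents through \<open>A\<close> at once. The case \<open>w = z\<close>
  covers the points of \<open>P\<close>, where the two tangents coincide.\<close>

definition meets :: "plane \<Rightarrow> plane \<Rightarrow> plane \<Rightarrow> bool" where
  "meets A w z \<longleftrightarrow> {v \<in> W. A \<in> dual_line F v} = {w, z}"

text \<open>Reflection in the line \<open>v \<bullet> u = q\<close>, which passes through
  \<open>g\<close> and is dual to \<open>L\<close>.\<close>

definition mirror :: "plane \<Rightarrow> plane" where
  "mirror w = w + (2 * (q - w \<bullet> u)) *\<^sub>R u"
text \<open>Projective dual of \<open>mirror\<close>, with center \<open>L\<close>. The denominator
  vanishes on the line orthogonal to \<open>u\<close> halfway between \<open>F\<close> and
  \<open>L\<close>, which misses \<open>S\<close>.\<close>

definition homology :: "plane \<Rightarrow> plane" where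
  "homology X = F + (1 / (1 - 2 * q * ((X - F) \<bullet> u))) *\<^sub>R
     (((X - F) \<bullet> rot u) *\<^sub>R rot u - ((X - F) \<bullet> u) *\<^sub>R u)"

lemma inner_uv: "X \<bullet> Y = (X \<bullet> u) * (Y \<bullet> u) + (X \<bullet> rot u) * (Y \<bullet> rot u)"
  using inner_self_decomp[of u X Y] u by simp

lemma eq_uvI: "X \<bullet> u = Y \<bullet> u \<Longrightarrow> X \<bullet> rot u = Y \<bullet> rot u \<Longrightarrow> X = Y"
  using plane_decomp[of u X] plane_decomp[of u Y] u by simp

lemma uv_simps [simp]: "u \<bullet> u = 1" "u \<bullet> rot u = 0" "rot u \<bullet> u = 0" "rot u \<bullet> rot u = 1"
  using u by simp_all

lemma g_uv [simp]: "g \<bullet> u = q" "g \<bullet> rot u = h"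
  by (simp_all add: g_def inner_add_left)

lemma g_nonzero: "g \<noteq> 0"
  by (metis g_uv(1) q inner_zero_left)

text \<open>Positivity of \<open>R\<^sup>2\<close>, multiplied by \<open>\<mu>\<^sup>2\<close>; it
  keeps \<open>L\<close> off the circle.\<close>

lemma \<mu>_less: "\<mu> < q\<^sup>2"
proof -
  have "0 < \<mu>\<^sup>2 * ((q / \<mu>)\<^sup>2 - 1 / \<mu>)" using R R2[symmetric] \<mu> by simp
  also have "\<dots> = q\<^sup>2 - \<mu>" using \<mu> by (simp add: field_simps power2_eq_square)
  finally show ?thesis by simp
qed

lemma mem_S_iff:
  "X \<in> S \<longleftrightarrow> \<mu> * (((X - F) \<bullet> u)\<^sup>2 + ((X - F) \<bullet> rot u)\<^sup>2) = 2 * q * ((X - F) \<bullet> u) - 1"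
proof -
  define x y where "x = (X - F) \<bullet> u" and "y = (X - F) \<bullet> rot u"
  let ?Z = "(F + (q / \<mu>) *\<^sub>R u) - X"
  have Z: "?Z \<bullet> u = q / \<mu> - x" "?Z \<bullet> rot u = - y"
    by (simp_all add: x_def y_def inner_add_left inner_diff_left)
  have "X \<in> S \<longleftrightarrow> norm ?Z = R" by (simp add: S_def dist_norm)
  also have "\<dots> \<longleftrightarrow> (norm ?Z)\<^sup>2 = R\<^sup>2" using R by simp
  also have "\<dots> \<longleftrightarrow> (q / \<mu> - x)\<^sup>2 + y\<^sup>2 = (q / \<mu>)\<^sup>2 - 1 / \<mu>"
    unfolding power2_norm_eq_inner inner_uv[of ?Z ?Z] Z R2 by (simp add: power2_eq_square)
  also have "\<dots> \<longleftrightarrow> \<mu> * (x\<^sup>2 + y\<^sup>2) = 2 * q * x - 1"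
  proof -
    have "\<mu> * ((q / \<mu> - x)\<^sup>2 + y\<^sup>2 - ((q / \<mu>)\<^sup>2 - 1 / \<mu>)) = \<mu> * (x\<^sup>2 + y\<^sup>2) - (2 * q * x - 1)"
      using \<mu> by (simp add: power2_eq_square field_simps)
    then show ?thesis using \<mu> by (metis eq_iff_diff_eq_0 mult_eq_0_iff)
  qed
  finally show ?thesis by (simp add: x_def y_def)
qed

lemma dual_line_uv:
  "X \<in> dual_line F w \<longleftrightarrow> ((X - F) \<bullet> u) * (w \<bullet> u) + ((X - F) \<bullet> rot u) * (w \<bullet> rot u) = 1"
  using inner_uv[of "X - F" w] by (simp add: dual_line_def)

lemma W_uv:
  "w \<in> W \<Longrightarrow> (w \<bullet> u)\<^sup>2 + (w \<bullet> rot u)\<^sup>2 = 2 * (q * (w \<bullet> u) + h * (w \<bullet> rot u))"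
  unfolding W_def using inner_uv[of w w] inner_uv[of g w] by (simp add: power2_eq_square)

lemma W_uvI:
  "(w \<bullet> u)\<^sup>2 + (w \<bullet> rot u)\<^sup>2 = 2 * (q * (w \<bullet> u) + h * (w \<bullet> rot u)) \<Longrightarrow> w \<noteq> 0 \<Longrightarrow> w \<in> W"
  unfolding W_def using inner_uv[of w w] inner_uv[of g w] by (simp add: power2_eq_square)

lemma W_sphere: "w \<in> W \<Longrightarrow> w \<in> sphere g (norm g)"
  unfolding W_def
  by (simp add: dist_norm norm_eq_sqrt_inner inner_diff_left inner_diff_right inner_commute)

lemma meets_sym: "meets A w z \<longleftrightarrow> meets A z w"
  by (simp add: meets_def insert_commute)

lemma meetsD: "meets A w z \<Longrightarrow> w \<in> W \<and> z \<in> W \<and> A \<in> dual_line F w \<and> A \<in> dual_line F z"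
  by (auto simp: meets_def)

lemma meets_mem: "meets A w z \<Longrightarrow> v \<in> W \<Longrightarrow> A \<in> dual_line F v \<Longrightarrow> v = w \<or> v = z"
  by (auto simp: meets_def)

text \<open>The lines through \<open>A\<close> form a line in the dual plane, which cuts the circle
  \<open>W\<close> in at most two points.\<close>

lemma meetsI:
  assumes "w \<in> W" "z \<in> W" "w \<noteq> z" "A \<in> dual_line F w" "A \<in> dual_line F z"
  shows "meets A w z"
proof -
  have "v = w \<or> v = z" if "v \<in> W" "A \<in> dual_line F v" for v
  proof (rule sphere_line_at_most_two[of w g "norm g" z v "A - F" 1])
    show "A - F \<noteq> 0" using assms(4) by (auto simp: dual_line_def)
  qed (use assms that W_sphere in \<open>auto simp: dual_line_def inner_commute\<close>)
  then show ?thesis using assms by (auto simp: meets_def)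
qed

lemma g_inner_W: "w \<in> W \<Longrightarrow> g \<bullet> w \<noteq> 0"
  by (auto simp: W_def)

text \<open>Dually, the tangent to \<open>W\<close> at \<open>w\<close> has no other point on
  \<open>W\<close>: the equations combine to \<open>(v - w) \<bullet> (v - w) = 0\<close>.\<close>

lemma touching_meets:
  assumes w: "w \<in> W"
  shows "meets (F + (1 / (g \<bullet> w)) *\<^sub>R (w - g)) w w"
proof -
  have ww: "w \<bullet> w = 2 * (g \<bullet> w)" using w by (simp add: W_def)
  have mem: "F + (1 / (g \<bullet> w)) *\<^sub>R (w - g) \<in> dual_line F w"
    using g_inner_W[OF w] ww by (simp add: dual_line_def inner_add_left inner_diff_left)
  have "v = w" if v: "v \<in> W" "F + (1 / (g \<bullet> w)) *\<^sub>R (w - g) \<in> dual_line F v" for v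
  proof -
    have "v \<bullet> v = 2 * (g \<bullet> v)" using v by (simp add: W_def)
    moreover have "(1 / (g \<bullet> w)) * ((w - g) \<bullet> v) = 1"
      using v(2) unfolding dual_line_def by simp
    then have "w \<bullet> v - g \<bullet> v = g \<bullet> w"
      using g_inner_W[OF w] by (simp add: inner_diff_left divide_eq_1_iff)
    ultimately have "(v - w) \<bullet> (v - w) = 0"
      using ww by (simp add: inner_diff_left inner_diff_right inner_commute)
    then show ?thesis by simp
  qed
  then show ?thesis using mem w by (auto simp: meets_def)
qed

text \<open>The second line is the mirror image of \<open>w\<close> in the line through the center \<open>g\<close> of \<open>W\<close>
  orthogonal to the chord dual to \<open>A\<close>.\<close>

lemma ex_meets:
  assumes w: "w \<in> W" and A: "A \<in> dual_line F w"
  obtains z where "meets A w z" "z = w \<Longrightarrow> A = F + (1 / (g \<bullet> w)) *\<^sub>R (w - g)"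
proof -
  define k where "k = rot (A - F)"
  have A0: "A - F \<noteq> 0" using A by (auto simp: dual_line_def)
  then have k0: "k \<bullet> k \<noteq> 0" by (simp add: k_def)
  define c where "c = 2 * ((w - g) \<bullet> k) / (k \<bullet> k)"
  define z where "z = w - c *\<^sub>R k"
  have Az: "A \<in> dual_line F z"
    using A by (simp add: dual_line_def z_def k_def inner_diff_right)
  have "c * (k \<bullet> k) = 2 * (w \<bullet> k - g \<bullet> k)" using k0 by (simp add: c_def inner_diff_left)
  then have "c * (c * (k \<bullet> k)) = c * (2 * (w \<bullet> k - g \<bullet> k))" by simp
  then have "z \<bullet> z = 2 * (g \<bullet> z)"
    using w by (simp add: z_def W_def inner_diff_left inner_diff_right inner_commute[of k w] algebra_simps)
  then have zW: "z \<in> W" using dual_line_nonzero[OF Az] by (simp add: W_def)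
  show thesis
  proof (cases "z = w")
    case False
    then show thesis using that meetsI[OF w zW _ A Az] by auto
  next
    case True
    \<comment> \<open>The reflection fixes \<open>w\<close> only if the dual chord is tangent to
      \<open>W\<close>; then the radius \<open>w - g\<close> is parallel to
      \<open>A - F\<close>.\<close>
    then have "(w - g) \<bullet> k = 0" using A0 k0 by (auto simp: z_def c_def k_def)
    then have wgk: "(w - g) \<bullet> rot (A - F) = 0" by (simp add: k_def)
    have "(A - F) \<bullet> w = 1" "w \<bullet> w = 2 * (g \<bullet> w)" using A w by (simp_all add: dual_line_def W_def)
    obtain s where s: "w - g = s *\<^sub>R (A - F)"
    proof
      have "((A - F) \<bullet> (A - F)) *\<^sub>R (w - g) = ((w - g) \<bullet> (A - F)) *\<^sub>R (A - F)"
        using plane_decomp[of "A - F" "w - g"] wgk by simp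
      then have "(1 / ((A - F) \<bullet> (A - F))) *\<^sub>R (((A - F) \<bullet> (A - F)) *\<^sub>R (w - g))
          = (1 / ((A - F) \<bullet> (A - F))) *\<^sub>R (((w - g) \<bullet> (A - F)) *\<^sub>R (A - F))" by (rule arg_cong)
      then show "w - g = (((w - g) \<bullet> (A - F)) / ((A - F) \<bullet> (A - F))) *\<^sub>R (A - F)"
        using A0 by simp
    qed
    have "(w - g) \<bullet> w = s" unfolding s using \<open>(A - F) \<bullet> w = 1\<close> by simp
    then have "s = g \<bullet> w" using \<open>w \<bullet> w = 2 * (g \<bullet> w)\<close> by (simp add: inner_diff_left)
    then have AT: "A = F + (1 / (g \<bullet> w)) *\<^sub>R (w - g)" using s g_inner_W[OF w] by simp
    show thesis using that[of w] touching_meets[OF w] AT by simp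
  qed
qed

lemma meets_touching:
  assumes "meets A w w"
  shows "A = F + (1 / (g \<bullet> w)) *\<^sub>R (w - g)"
proof -
  have wA: "w \<in> W" "A \<in> dual_line F w" using meetsD[OF assms] by auto
  obtain z where z: "meets A w z" "z = w \<Longrightarrow> A = F + (1 / (g \<bullet> w)) *\<^sub>R (w - g)"
    using ex_meets[OF wA] by metis
  have "z = w" using meets_mem[OF assms] meetsD[OF z(1)] by auto
  then show ?thesis using z(2) by simp
qed

lemma meets_touching_mem_P: "meets A w w \<Longrightarrow> A \<in> P"
  using meets_touching touching_point_mem_parabola[OF g_nonzero] meetsD
  unfolding P_def W_def by force

text \<open>For \<open>w \<noteq> z\<close>, a second common point would make both orthogonal to
  \<open>A - B\<close>, hence parallel, and equal because both pair to 1 with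
  \<open>A - F\<close>.\<close>

lemma meets_unique:
  assumes "meets A w z" "meets B w z"
  shows "A = B"
proof (cases "w = z")
  case True
  then show ?thesis using assms meets_touching by metis
next
  case False
  have AB: "(A - B) \<bullet> w = 0" "(A - B) \<bullet> z = 0" "(A - F) \<bullet> w = 1" "(A - F) \<bullet> z = 1"
    using meetsD[OF assms(1)] meetsD[OF assms(2)] by (auto simp: dual_line_def inner_diff_left)
  show ?thesis
  proof (rule ccontr)
    assume "A \<noteq> B"
    then have "w \<bullet> (A - B) = 0" "z \<bullet> (A - B) = 0" "A - B \<noteq> 0" using AB by (simp_all add: inner_commute)
    then obtain s t where st: "w = s *\<^sub>R rot (A - B)" "z = t *\<^sub>R rot (A - B)"
      by (metis orthogonal_imp_scaled_rot)
    then have "s * ((A - F) \<bullet> rot (A - B)) = 1" "t * ((A - F) \<bullet> rot (A - B)) = 1"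
      using AB by simp_all
    then have "s = t" by (metis mult_cancel_right mult_zero_left zero_neq_one mult_zero_right)
    then show False using st False by simp
  qed
qed

section \<open>The mirror symmetry and incidence with the circle\<close>

lemma mirror_uv [simp]: "mirror w \<bullet> u = 2 * q - w \<bullet> u" "mirror w \<bullet> rot u = w \<bullet> rot u"
  by (simp_all add: mirror_def inner_add_left)

lemma mirror_mirror [simp]: "mirror (mirror w) = w"
  by (rule eq_uvI) simp_all

text \<open>The center \<open>g\<close> is on the axis, so the circle is preserved; only the point
  \<open>2q u\<close> would be sent to the excluded origin.\<close>

lemma mirror_W: "w \<in> W \<Longrightarrow> mirror w \<noteq> 0 \<Longrightarrow> mirror w \<in> W"
  using W_uv[of w] by (intro W_uvI) (simp_all add: power2_eq_square algebra_simps)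

text \<open>With the coordinate along \<open>rot u\<close> fixed, the equation of \<open>W\<close>
  is a quadratic in the other coordinate, with root sum \<open>2 * q\<close>.\<close>

lemma W_eq_or_mirror:
  assumes "w \<in> W" "z \<in> W" "w \<bullet> rot u = z \<bullet> rot u"
  shows "z = w \<or> z = mirror w"
proof -
  have "(z \<bullet> u - w \<bullet> u) * (z \<bullet> u - (2 * q - w \<bullet> u)) = 0"
    using W_uv[OF assms(1)] W_uv[OF assms(2)] assms(3) by (simp add: power2_eq_square algebra_simps)
  then have "z \<bullet> u = w \<bullet> u \<or> z \<bullet> u = mirror w \<bullet> u" by simp
  then show ?thesis using assms(3) eq_uvI[of z w] eq_uvI[of z "mirror w"] by auto
qed

text \<open>The squared distance of the two lines cancels from the equation of the circle, which
  leaves a condition on the product of two coordinates.\<close>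

lemma cross_identity:
  fixes w1 w2 z1 z2 :: real
  assumes "w1\<^sup>2 + w2\<^sup>2 = 2 * (q * w1 + h * w2)" "z1\<^sup>2 + z2\<^sup>2 = 2 * (q * z1 + h * z2)"
  defines "d \<equiv> w1 * z2 - w2 * z1"
  shows "2 * q * (z2 - w2) * d - d\<^sup>2 = - (w2 * z2 * ((w1 - z1)\<^sup>2 + (w2 - z2)\<^sup>2))"
  using assms(1,2) unfolding d_def by algebra

text \<open>Multiplying the equation of \<open>S\<close> by the squared Cramer determinant
  \<open>d\<close> turns it into \<open>N * (w2 * z2 + \<mu>) = 0\<close>, where \<open>N\<close> is
  the squared distance of \<open>w\<close> and \<open>z\<close>. In the tangent case
  \<open>g \<bullet> w\<close> takes the place of the determinant and \<open>g \<bullet> g\<close>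
  that of \<open>N\<close>.\<close>

lemma meets_mem_S_iff:
  assumes m: "meets A w z"
  shows "A \<in> S \<longleftrightarrow> (w \<bullet> rot u) * (z \<bullet> rot u) = - \<mu>"
proof (cases "w = z")
  case True
  define w1 w2 where "w1 = w \<bullet> u" and "w2 = w \<bullet> rot u"
  have w: "w \<in> W" using meetsD[OF m] by simp
  have circ: "w1\<^sup>2 + w2\<^sup>2 = 2 * (q * w1 + h * w2)"
    using W_uv[OF w] by (simp add: w1_def w2_def)
  define d where "d = q * w1 + h * w2"
  have gw: "g \<bullet> w = d" using inner_uv[of g w] by (simp add: w1_def w2_def d_def)
  have d: "d \<noteq> 0" using g_inner_W[OF w] gw by simp
  have "A = F + (1 / d) *\<^sub>R (w - g)" using meets_touching[of A w] m True gw by simp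
  then have A: "(A - F) \<bullet> u = (w1 - q) / d" "(A - F) \<bullet> rot u = (w2 - h) / d"
    by (simp_all add: inner_diff_left w1_def w2_def)
  have "q \<noteq> 0" by (rule q)
  then have N: "q\<^sup>2 + h\<^sup>2 \<noteq> 0" by (simp add: sum_power2_eq_zero_iff)
  have "d\<^sup>2 * (\<mu> * (((w1 - q) / d)\<^sup>2 + ((w2 - h) / d)\<^sup>2) - (2 * q * ((w1 - q) / d) - 1))
      = \<mu> * ((w1 - q)\<^sup>2 + (w2 - h)\<^sup>2) - (2 * q * (w1 - q) * d - d\<^sup>2)"
    using d by (simp add: field_simps power2_eq_square)
  also have "\<dots> = (q\<^sup>2 + h\<^sup>2) * (w2 * w2 + \<mu>)"
    using circ unfolding d_def by algebra
  finally have "A \<in> S \<longleftrightarrow> w2 * w2 + \<mu> = 0"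
    unfolding mem_S_iff A using d N by (metis eq_iff_diff_eq_0 mult_eq_0_iff power2_eq_square)
  then show ?thesis using True by (simp add: w2_def add_eq_0_iff2)
next
  case False
  define x y where "x = (A - F) \<bullet> u" and "y = (A - F) \<bullet> rot u"
  define w1 w2 z1 z2 where "w1 = w \<bullet> u" and "w2 = w \<bullet> rot u" and "z1 = z \<bullet> u" and "z2 = z \<bullet> rot u"
  have circ: "w1\<^sup>2 + w2\<^sup>2 = 2 * (q * w1 + h * w2)" "z1\<^sup>2 + z2\<^sup>2 = 2 * (q * z1 + h * z2)"
    using meetsD[OF m] W_uv by (simp_all add: w1_def w2_def z1_def z2_def)
  have lin: "x * w1 + y * w2 = 1" "x * z1 + y * z2 = 1"
    using meetsD[OF m] dual_line_uv by (simp_all add: w1_def w2_def z1_def z2_def x_def y_def)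
  define d where "d = w1 * z2 - w2 * z1"
  define N where "N = (w1 - z1)\<^sup>2 + (w2 - z2)\<^sup>2"
  \<comment> \<open>Cramer's rule for the intersection of the two lines.\<close>
  have d: "x * d = z2 - w2" "y * d = w1 - z1" using lin unfolding d_def by algebra+
  have "w1 \<noteq> z1 \<or> w2 \<noteq> z2"
    using False eq_uvI[of w z] by (auto simp: w1_def w2_def z1_def z2_def)
  then have N0: "N \<noteq> 0" and d0: "d \<noteq> 0" using d by (auto simp: N_def sum_power2_eq_zero_iff)
  have "d\<^sup>2 * (\<mu> * (x\<^sup>2 + y\<^sup>2) - (2 * q * x - 1)) = \<mu> * ((x * d)\<^sup>2 + (y * d)\<^sup>2) - (2 * q * (x * d) * d - d\<^sup>2)"
    by (simp add: algebra_simps power2_eq_square)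
  also have "\<dots> = N * (w2 * z2 + \<mu>)"
    using cross_identity[OF circ] unfolding d N_def d_def[symmetric]
    by (simp add: power2_commute[of z2 w2] algebra_simps)
  finally have "A \<in> S \<longleftrightarrow> w2 * z2 + \<mu> = 0"
    unfolding mem_S_iff x_def[symmetric] y_def[symmetric] using d0 N0
    by (metis eq_iff_diff_eq_0 mult_eq_0_iff power2_eq_square)
  then show ?thesis by (simp add: w2_def z2_def add_eq_0_iff2)
qed

text \<open>Distinct lines could still be parallel, but a zero determinant in
  \<open>cross_identity\<close> would give \<open>\<mu> = 0\<close> or \<open>w = z\<close>.\<close>

lemma ex_meets_of_product:
  assumes W: "w \<in> W" "z \<in> W" and pr: "(w \<bullet> rot u) * (z \<bullet> rot u) = - \<mu>"
  obtains A where "meets A w z" "A \<in> S"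
proof -
  have "\<exists>A. meets A w z"
  proof (cases "w = z")
    case True
    then show ?thesis using touching_meets W by blast
  next
    case False
    define w1 w2 z1 z2 where "w1 = w \<bullet> u" and "w2 = w \<bullet> rot u" and "z1 = z \<bullet> u" and "z2 = z \<bullet> rot u"
    have circ: "w1\<^sup>2 + w2\<^sup>2 = 2 * (q * w1 + h * w2)" "z1\<^sup>2 + z2\<^sup>2 = 2 * (q * z1 + h * z2)"
      using W W_uv by (simp_all add: w1_def w2_def z1_def z2_def)
    have "w1 \<noteq> z1 \<or> w2 \<noteq> z2"
      using False eq_uvI[of w z] by (auto simp: w1_def w2_def z1_def z2_def)
    then have "(w1 - z1)\<^sup>2 + (w2 - z2)\<^sup>2 \<noteq> 0" by (auto simp: sum_power2_eq_zero_iff)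
    moreover define d where "d = w1 * z2 - w2 * z1"
    have "2 * q * (z2 - w2) * d - d\<^sup>2 = \<mu> * ((w1 - z1)\<^sup>2 + (w2 - z2)\<^sup>2)"
      using cross_identity[OF circ] pr by (simp add: d_def w2_def[symmetric] z2_def[symmetric])
    ultimately have d: "d \<noteq> 0" using \<mu> by auto
    define A where "A = F + (1 / d) *\<^sub>R ((z2 - w2) *\<^sub>R u + (w1 - z1) *\<^sub>R rot u)"
    have A: "(A - F) \<bullet> u = (z2 - w2) / d" "(A - F) \<bullet> rot u = (w1 - z1) / d"
      by (simp_all add: A_def inner_add_left)
    have "A \<in> dual_line F w" "A \<in> dual_line F z"
      unfolding dual_line_uv A w1_def[symmetric] w2_def[symmetric] z1_def[symmetric] z2_def[symmetric]
      using d by (simp_all add: divide_simps) (simp_all add: d_def algebra_simps)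
    then show ?thesis using meetsI W False by blast
  qed
  then show thesis using that meets_mem_S_iff pr by blast
qed

text \<open>On the line in question the equation of \<open>S\<close> leaves only
  \<open>A = F\<close>, and \<open>F\<close> is not on that line.\<close>

lemma S_nonzero:
  assumes "A \<in> S"
  shows "1 - 2 * q * ((A - F) \<bullet> u) \<noteq> 0"
proof
  assume 0: "1 - 2 * q * ((A - F) \<bullet> u) = 0"
  then have "((A - F) \<bullet> u)\<^sup>2 + ((A - F) \<bullet> rot u)\<^sup>2 = 0"
    using assms \<mu> unfolding mem_S_iff by simp
  then have "(A - F) \<bullet> u = 0" by (simp add: sum_power2_eq_zero_iff)
  then show False using 0 by simp
qed

lemma homology_uv:
  "(homology A - F) \<bullet> u = - ((A - F) \<bullet> u) / (1 - 2 * q * ((A - F) \<bullet> u))"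
  "(homology A - F) \<bullet> rot u = ((A - F) \<bullet> rot u) / (1 - 2 * q * ((A - F) \<bullet> u))"
  by (simp_all add: homology_def inner_diff_left[of "_ *\<^sub>R _"] del: mult_minus_left)

lemma homology_dual_line_iff:
  assumes "A \<in> S"
  shows "homology A \<in> dual_line F (mirror v) \<longleftrightarrow> A \<in> dual_line F v"
  unfolding dual_line_uv homology_uv using S_nonzero[OF assms]
  by (simp add: divide_simps) (auto simp: algebra_simps)

lemma meets_homology:
  assumes m: "meets A w z" and A: "A \<in> S"
  shows "meets (homology A) (mirror w) (mirror z)"
proof -
  \<comment> \<open>\<open>mirror v\<close> is nonzero because its dual line contains
    \<open>homology A\<close>, so it stays in \<open>W\<close>.\<close>
  have r: "mirror v \<in> W \<and> homology A \<in> dual_line F (mirror v)" if "v \<in> W" "A \<in> dual_line F v" for v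
    using that homology_dual_line_iff[OF A] mirror_W dual_line_nonzero by blast
  have "v = mirror w \<or> v = mirror z" if v: "v \<in> W" "homology A \<in> dual_line F v" for v
  proof -
    have "A \<in> dual_line F (mirror v)" using v(2) homology_dual_line_iff[OF A, of "mirror v"] by simp
    then have "mirror v = w \<or> mirror v = z"
      using meets_mem[OF m] mirror_W[OF v(1)] dual_line_nonzero by blast
    then show ?thesis by (metis mirror_mirror)
  qed
  then show ?thesis using r meetsD[OF m] by (auto simp: meets_def)
qed

lemma L_between_homology:
  assumes A: "A \<in> S" and ne: "homology A \<noteq> A"
  shows "L \<in> affine hull {A, homology A}"
proof -
  define x y where "x = (A - F) \<bullet> u" and "y = (A - F) \<bullet> rot u"
  define d where "d = 1 - 2 * q * x"
  have d: "d \<noteq> 0" using S_nonzero[OF A] by (simp add: d_def x_def)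
  have H: "(homology A - F) \<bullet> u = - x / d" "(homology A - F) \<bullet> rot u = y / d"
    by (simp_all add: homology_uv x_def y_def d_def)
  have x: "x \<noteq> 0"
  proof
    assume "x = 0"
    then have "homology A - F = A - F"
      using H d by (intro eq_uvI) (simp_all add: x_def y_def d_def)
    then show False using ne by simp
  qed
  \<comment> \<open>Equals \<open>d / (d - 1)\<close>, chosen to cancel the component along
    \<open>rot u\<close>.\<close>
  define t where "t = d / (- (2 * q * x))"
  have "(1 - t) *\<^sub>R (A - F) + t *\<^sub>R (homology A - F) = (1 / q) *\<^sub>R u"
  proof (rule eq_uvI)
    show "((1 - t) *\<^sub>R (A - F) + t *\<^sub>R (homology A - F)) \<bullet> u = ((1 / q) *\<^sub>R u) \<bullet> u"
      unfolding inner_add_left inner_scaleR_left H x_def[symmetric] t_def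
      using x q d by (simp add: divide_simps) (simp add: d_def algebra_simps)
    show "((1 - t) *\<^sub>R (A - F) + t *\<^sub>R (homology A - F)) \<bullet> rot u = ((1 / q) *\<^sub>R u) \<bullet> rot u"
      unfolding inner_add_left inner_scaleR_left H y_def[symmetric] t_def
      using x q d by (simp add: divide_simps) (simp add: d_def algebra_simps)
  qed
  then have "L = (1 - t) *\<^sub>R A + t *\<^sub>R homology A"
    unfolding L_def by (simp add: algebra_simps)
  then show ?thesis unfolding affine_hull_2 by force
qed

lemma L_uv: "(L - F) \<bullet> u = 1 / q" "(L - F) \<bullet> rot u = 0"
  by (simp_all add: L_def)

lemma L_notin_S: "L \<notin> S"
proof
  assume "L \<in> S"
  then have "\<mu> * (1 / q)\<^sup>2 = 1" unfolding mem_S_iff L_uv using q by simp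
  then have "\<mu> = q\<^sup>2" using q by (simp add: field_simps)
  then show False using \<mu>_less by simp
qed

lemma L_mem_dual_line_iff: "L \<in> dual_line F w \<longleftrightarrow> mirror w = w"
proof -
  have "L \<in> dual_line F w \<longleftrightarrow> w \<bullet> u = q" unfolding dual_line_uv L_uv using q by (auto simp: divide_eq_1_iff)
  also have "\<dots> \<longleftrightarrow> mirror w = w" using mirror_uv(1)[of w] by (auto simp: mirror_def)
  finally show ?thesis .
qed

lemma product_nonzero:
  assumes "meets A w z" "A \<in> S"
  shows "w \<bullet> rot u \<noteq> 0" "z \<bullet> rot u \<noteq> 0"
  using meets_mem_S_iff[OF assms(1)] assms(2) \<mu> by auto

lemma mirror_W_of_meets:
  assumes "meets A w z" "A \<in> S"
  shows "mirror w \<in> W" "mirror z \<in> W"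
  using product_nonzero[OF assms] meetsD[OF assms(1)] mirror_W
  by (metis inner_zero_left mirror_uv(2))+

text \<open>Reflection keeps the coordinate along \<open>rot u\<close>, so the product criterion
  carries over from \<open>z\<close> to \<open>mirror z\<close>.\<close>

lemma ex_second_meets:
  assumes "meets A w z" "A \<in> S"
  obtains B where "meets B w (mirror z)" "B \<in> S"
  using ex_meets_of_product[of w "mirror z"] mirror_W_of_meets[OF assms] meetsD[OF assms(1)]
    meets_mem_S_iff[OF assms(1)] assms(2) by auto

text \<open>At any point of \<open>S\<close> on the line \<open>w\<close>, the product criterion
  fixes the coordinate of the other tangent along \<open>rot u\<close>, so this tangent is
  \<open>z\<close> or \<open>mirror z\<close>.\<close>

lemma chord:
  assumes m: "meets A w z" "meets B w (mirror z)" and A: "A \<in> S"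
  shows "dual_line F w \<inter> S = {A, B}"
proof
  have "B \<in> S" using m A meets_mem_S_iff[OF m(1)] meets_mem_S_iff[OF m(2)] by simp
  then show "{A, B} \<subseteq> dual_line F w \<inter> S" using meetsD m A by blast
  show "dual_line F w \<inter> S \<subseteq> {A, B}"
  proof
    fix X assume X: "X \<in> dual_line F w \<inter> S"
    have w: "w \<in> W" using meetsD[OF m(1)] by simp
    obtain y where y: "meets X w y" using ex_meets[OF w] X by blast
    have "(w \<bullet> rot u) * (y \<bullet> rot u) = (w \<bullet> rot u) * (z \<bullet> rot u)"
      using meets_mem_S_iff[OF y] meets_mem_S_iff[OF m(1)] X A by simp
    then have "z \<bullet> rot u = y \<bullet> rot u" using product_nonzero[OF m(1) A] by simp
    then have "y = z \<or> y = mirror z" using W_eq_or_mirror meetsD[OF m(1)] meetsD[OF y] by blast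
    then show "X \<in> {A, B}" using y m meets_unique by blast
  qed
qed

lemma second_intersection_meets:
  assumes m: "meets A w z" and A: "A \<in> S" and B: "second_intersection S (dual_line F w) A B"
  shows "meets B w (mirror z)"
proof -
  obtain B' where B': "meets B' w (mirror z)" using ex_second_meets[OF m A] .
  have "{A, B} = {A, B'}" using chord[OF m B' A] B by (simp add: second_intersection_def)
  then show ?thesis using B' by (auto simp: doubleton_eq_iff)
qed

lemma opposite_homology:
  assumes A: "meets A w z" "A \<in> S" and C: "meets C (mirror w) (mirror z)"
  shows "C = homology A"
  using meets_unique[OF C meets_homology[OF A]] .

text \<open>The tangents at \<open>B\<close> are \<open>w\<close>, \<open>mirror z\<close> and those
  at \<open>D\<close> are \<open>z\<close>, \<open>mirror w\<close>. So \<open>D\<close> is the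
  image of \<open>B\<close> under the homology with center \<open>L\<close>.\<close>

lemma L_on_diagonal:
  assumes A: "A \<in> S" and wz: "w \<in> W" "z \<in> W" "w \<noteq> z" "A \<in> dual_line F w" "A \<in> dual_line F z"
    and B: "second_intersection S (dual_line F w) A B"
    and D: "second_intersection S (dual_line F z) A D"
  shows "L \<in> affine hull {B, D}"
proof -
  have m: "meets A w z" using meetsI wz by blast
  have mB: "meets B w (mirror z)" using second_intersection_meets[OF m A B] .
  have mD: "meets D z (mirror w)"
    using second_intersection_meets[OF _ A D] m meets_sym by blast
  have BS: "B \<in> S" using B by (auto simp: second_intersection_def)
  have D: "D = homology B" using opposite_homology[OF mB BS] mD meets_sym by simp
  \<comment> \<open>If they agreed, both \<open>w\<close> and \<open>z\<close> would be fixed by the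
    reflection and so pass through \<open>L\<close>, which would put \<open>L = A\<close> on the
    circle.\<close>
  have "D \<noteq> B"
  proof
    assume "D = B"
    then have "{w, mirror z} = {z, mirror w}" using mB mD by (simp add: meets_def)
    then have "mirror w = w" "mirror z = z" using wz(3) by (auto simp: doubleton_eq_iff)
    then have "meets L w z" using meetsI wz L_mem_dual_line_iff by blast
    then show False using meets_unique m A L_notin_S by blast
  qed
  then show ?thesis using L_between_homology[OF BS] D by simp
qed

lemma tangent_iff: "tangent_to t P \<longleftrightarrow> (\<exists>w \<in> W. t = dual_line F w)"
  unfolding P_def tangent_to_parabola_iff[OF g_nonzero] W_def by blast

section \<open>Poncelet quadrilaterals\<close>

lemma W_nonzero: "w \<in> W \<Longrightarrow> w \<noteq> 0"
  by (simp add: W_def)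

lemma not_three_on_line:
  assumes "A \<in> S" "B \<in> S" "C \<in> S" "A \<in> dual_line F w" "B \<in> dual_line F w" "C \<in> dual_line F w"
    and "A \<noteq> B" "A \<noteq> C" "B \<noteq> C"
  shows False
  using sphere_line_at_most_two[of A _ R B C w "1 + F \<bullet> w"] assms dual_line_nonzero[of A F w]
  unfolding S_def dual_line_eq_hyperplane by blast

text \<open>The side lines in cyclic order are \<open>w\<close>, \<open>mirror z\<close>,
  \<open>mirror w\<close>, \<open>z\<close>, beginning with \<open>AB\<close>; coincidences are
  allowed.\<close>

definition quad_meets :: "plane \<Rightarrow> plane \<Rightarrow> plane \<Rightarrow> plane \<Rightarrow> plane \<Rightarrow> plane \<Rightarrow> bool" where
  "quad_meets A B C D w z \<longleftrightarrow> A \<in> S \<and> B \<in> S \<and> C \<in> S \<and> D \<in> S \<and>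
     meets A w z \<and> meets B w (mirror z) \<and> meets C (mirror w) (mirror z) \<and> meets D (mirror w) z"

lemma ex_quad_meets:
  assumes A: "meets A w z" "A \<in> S"
  obtains B C D where "quad_meets A B C D w z"
proof -
  obtain B where B: "meets B w (mirror z)" "B \<in> S" using ex_second_meets[OF A] .
  obtain D where D: "meets D z (mirror w)" "D \<in> S"
    using ex_second_meets[of A z w] A meets_sym by blast
  obtain C where C: "meets C (mirror z) (mirror w)" "C \<in> S"
    using ex_second_meets[of B "mirror z" w] B meets_sym by blast
  have "quad_meets A B C D w z" using A B C D meets_sym by (simp add: quad_meets_def)
  then show thesis by (rule that)
qed

lemma quad_meets_closed:
  assumes q: "quad_meets A B C D w z" and wz: "w \<noteq> z"
  shows "poncelet_closed4 S P A B C D"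
proof -
  have m: "meets A w z" "meets B w (mirror z)" "meets C (mirror w) (mirror z)" "meets D (mirror w) z"
    and S: "A \<in> S" "B \<in> S" "C \<in> S" "D \<in> S"
    using q by (simp_all add: quad_meets_def)
  have "dual_line F w \<inter> S = {A, B}" using chord[OF m(1,2) S(1)] .
  moreover have "dual_line F (mirror z) \<inter> S = {B, C}"
    using chord[of B "mirror z" w C] m S meets_sym by blast
  moreover have "dual_line F (mirror w) \<inter> S = {C, D}"
    using chord[of C "mirror w" "mirror z" D] m S by simp
  moreover have "dual_line F z \<inter> S = {D, A}"
    using chord[of D z "mirror w" A] m S meets_sym by simp
  moreover have "tangent_to (dual_line F w) P" "tangent_to (dual_line F z) P"
    "tangent_to (dual_line F (mirror w)) P" "tangent_to (dual_line F (mirror z)) P"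
    using tangent_iff meetsD m by blast+
  moreover have "dual_line F z \<noteq> dual_line F w" "dual_line F (mirror z) \<noteq> dual_line F (mirror w)"
    using wz dual_line_inject meetsD m W_nonzero by (metis mirror_mirror)+
  \<comment> \<open>If these adjacent sides coincide, \<open>B\<close> is their contact point with
    \<open>P\<close>.\<close>
  moreover have "dual_line F w \<noteq> dual_line F (mirror z) \<or> B \<in> P"
    using dual_line_inject[of w F "mirror z"] meetsD[OF m(2)] W_nonzero meets_touching_mem_P m(2) by auto
  moreover have "dual_line F (mirror w) \<noteq> dual_line F z \<or> D \<in> P"
    using dual_line_inject[of "mirror w" F z] meetsD[OF m(4)] W_nonzero meets_touching_mem_P m(4) by auto
  ultimately show ?thesis
    unfolding poncelet_closed4_def second_intersection_def by blast
qed

text \<open>The inequalities make the four unordered pairs of tangents distinct, and a vertex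
  determines its pair.\<close>

lemma quad_meets_poncelet:
  assumes q: "quad_meets A B C D w z"
    and ne: "w \<noteq> z" "w \<noteq> mirror z" "mirror w \<noteq> w" "mirror z \<noteq> z"
  shows "poncelet_quadrilateral S P A B C D"
proof -
  have m: "meets A w z" "meets B w (mirror z)" "meets C (mirror w) (mirror z)" "meets D (mirror w) z"
    and S: "A \<in> S" "B \<in> S" "C \<in> S" "D \<in> S"
    using q by (simp_all add: quad_meets_def)
  have "mirror w \<noteq> mirror z" "mirror w \<noteq> z" using ne mirror_mirror by metis+
  then have sets: "{w, z} \<noteq> {w, mirror z}" "{w, z} \<noteq> {mirror w, mirror z}" "{w, z} \<noteq> {mirror w, z}"
    "{w, mirror z} \<noteq> {mirror w, mirror z}" "{w, mirror z} \<noteq> {mirror w, z}" "{mirror w, mirror z} \<noteq> {mirror w, z}"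
    using ne by (auto simp: doubleton_eq_iff)
  have neq: "X \<noteq> Y" if "meets X a b" "meets Y c d" "{a, b} \<noteq> {c, d}" for X Y a b c d
    using that unfolding meets_def by blast
  have dist: "A \<noteq> B" "A \<noteq> C" "A \<noteq> D" "B \<noteq> C" "B \<noteq> D" "C \<noteq> D"
    using neq[OF m(1,2) sets(1)] neq[OF m(1,3) sets(2)] neq[OF m(1,4) sets(3)]
      neq[OF m(2,3) sets(4)] neq[OF m(2,4) sets(5)] neq[OF m(3,4) sets(6)] .
  have "affine hull {A, B} = dual_line F w" "affine hull {B, C} = dual_line F (mirror z)"
    "affine hull {C, D} = dual_line F (mirror w)" "affine hull {D, A} = dual_line F z"
    using dist meetsD[OF m(1)] meetsD[OF m(2)] meetsD[OF m(3)] meetsD[OF m(4)]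
    by (simp_all add: affine_hull_eq_dual_line)
  then have "circumscribed P A B C D"
    unfolding circumscribed_def tangent_iff using meetsD[OF m(1)] meetsD[OF m(3)] by blast
  then show ?thesis using dist S by (simp add: poncelet_quadrilateral_def inscribed_def)
qed

text \<open>Since a line holds at most two points of \<open>S\<close>, the four side lines are
  distinct. The product criterion at \<open>A\<close>, \<open>B\<close>, \<open>C\<close> gives
  opposite sides equal coordinates along \<open>rot u\<close>, so they are mirror images.\<close>

lemma poncelet_quad_meets:
  assumes pq: "poncelet_quadrilateral S P A B C D"
  obtains w z where "quad_meets A B C D w z" "mirror w \<noteq> w" "mirror z \<noteq> z"
    "affine hull {A, B} = dual_line F w" "affine hull {B, C} = dual_line F (mirror z)"
    "affine hull {C, D} = dual_line F (mirror w)" "affine hull {D, A} = dual_line F z"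
proof -
  have dist: "A \<noteq> B" "A \<noteq> C" "A \<noteq> D" "B \<noteq> C" "B \<noteq> D" "C \<noteq> D"
    and S: "A \<in> S" "B \<in> S" "C \<in> S" "D \<in> S"
    using pq by (auto simp: poncelet_quadrilateral_def inscribed_def)
  obtain w1 w2 w3 w4 where w: "w1 \<in> W" "w2 \<in> W" "w3 \<in> W" "w4 \<in> W"
    and hull: "affine hull {A, B} = dual_line F w1" "affine hull {B, C} = dual_line F w2"
      "affine hull {C, D} = dual_line F w3" "affine hull {D, A} = dual_line F w4"
    using pq unfolding poncelet_quadrilateral_def circumscribed_def tangent_iff by blast
  have on: "A \<in> dual_line F w1" "B \<in> dual_line F w1" "B \<in> dual_line F w2" "C \<in> dual_line F w2"
      "C \<in> dual_line F w3" "D \<in> dual_line F w3" "D \<in> dual_line F w4" "A \<in> dual_line F w4"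
    unfolding hull[symmetric] by (auto intro: hull_inc)
  have ne: "w1 \<noteq> w2" "w2 \<noteq> w3" "w3 \<noteq> w4" "w1 \<noteq> w4" "w1 \<noteq> w3" "w2 \<noteq> w4"
    using not_three_on_line[of A B C w1] not_three_on_line[of B C D w2]
      not_three_on_line[of C D A w3] not_three_on_line[of D A B w4] S on dist by metis+
  have m: "meets A w1 w4" "meets B w1 w2" "meets C w3 w2" "meets D w3 w4"
    using meetsI w ne on by metis+
  have pr: "(w1 \<bullet> rot u) * (w4 \<bullet> rot u) = - \<mu>" "(w1 \<bullet> rot u) * (w2 \<bullet> rot u) = - \<mu>"
      "(w3 \<bullet> rot u) * (w2 \<bullet> rot u) = - \<mu>"
    using meets_mem_S_iff m S by blast+
  have "w4 \<bullet> rot u = w2 \<bullet> rot u" "w1 \<bullet> rot u = w3 \<bullet> rot u"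
    using pr \<mu> by (metis mult_cancel_left mult_cancel_right mult_zero_left mult_zero_right neg_equal_0_iff_equal)+
  then have r: "w2 = mirror w4" "w3 = mirror w1"
    using W_eq_or_mirror w ne by metis+
  show thesis
    using that[of w1 w4] m hull S ne r by (simp add: quad_meets_def)
qed

lemma poncelet_diagonals:
  assumes pq: "poncelet_quadrilateral S P A B C D"
  shows "affine hull {A, C} \<inter> affine hull {B, D} = {L}"
proof -
  obtain w z where q: "quad_meets A B C D w z" using poncelet_quad_meets[OF pq] .
  have m: "meets A w z" "meets B w (mirror z)" "meets C (mirror w) (mirror z)" "meets D (mirror w) z"
    and S: "A \<in> S" "B \<in> S" "C \<in> S" "D \<in> S"
    using q by (simp_all add: quad_meets_def)
  have dist: "A \<noteq> B" "A \<noteq> C" "A \<noteq> D" "B \<noteq> C" "B \<noteq> D" "C \<noteq> D"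
    using pq by (auto simp: poncelet_quadrilateral_def)
  have "C = homology A" "D = homology B"
    using opposite_homology m S by (metis mirror_mirror)+
  then have L: "L \<in> affine hull {A, C}" "L \<in> affine hull {B, D}"
    using L_between_homology S dist by metis+
  have "X = L" if X: "X \<in> affine hull {A, C}" "X \<in> affine hull {B, D}" for X
  proof (rule ccontr)
    \<comment> \<open>Both diagonals would be the line \<open>XL\<close>, making three points of the
      circle collinear.\<close>
    assume "X \<noteq> L"
    obtain n c where n: "n \<noteq> 0" "affine hull {A, C} = {X. X \<bullet> n = c}"
      using is_lineE[of "affine hull {A, C}"] dist unfolding is_line_def by metis
    obtain n' c' where n': "n' \<noteq> 0" "affine hull {B, D} = {X. X \<bullet> n' = c'}"
      using is_lineE[of "affine hull {B, D}"] dist unfolding is_line_def by metis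
    have "affine hull {X, L} = {X. X \<bullet> n = c}" "affine hull {X, L} = {X. X \<bullet> n' = c'}"
      using affine_hull_pair_eq_hyperplane[OF \<open>X \<noteq> L\<close>, of n c]
        affine_hull_pair_eq_hyperplane[OF \<open>X \<noteq> L\<close>, of n' c'] n n' X L by simp_all
    then have "affine hull {B, D} = {X. X \<bullet> n = c}" using n' by simp
    then have "A \<bullet> n = c" "B \<bullet> n = c" "C \<bullet> n = c"
      using n(2) hull_inc[of _ "{A, C}" affine] hull_inc[of _ "{B, D}" affine] by auto
    then show False
      using sphere_line_at_most_two[OF _ _ _ n(1), of A _ R B C c] S dist unfolding S_def by blast
  qed
  then show ?thesis using L by blast
qed

text \<open>The two equations differ only in the coefficient along \<open>u\<close>, so a common
  point has no \<open>u\<close>-component: it lies on the axis of the homology.\<close>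

lemma dual_line_mirror_inter:
  assumes "mirror w \<noteq> w" "w \<bullet> rot u \<noteq> 0"
  shows "\<exists>X. dual_line F w \<inter> dual_line F (mirror w) = {X} \<and> (X - F) \<bullet> u = 0"
proof -
  have wu: "w \<bullet> u - q \<noteq> 0" using assms(1) by (auto simp: mirror_def)
  let ?X = "F + (1 / (w \<bullet> rot u)) *\<^sub>R rot u"
  have X: "(?X - F) \<bullet> u = 0" "(?X - F) \<bullet> rot u = 1 / (w \<bullet> rot u)" by simp_all
  have "Y = ?X" if "Y \<in> dual_line F w" "Y \<in> dual_line F (mirror w)" for Y
  proof -
    have Y: "((Y - F) \<bullet> u) * (w \<bullet> u) + ((Y - F) \<bullet> rot u) * (w \<bullet> rot u) = 1"
      "((Y - F) \<bullet> u) * (2 * q - w \<bullet> u) + ((Y - F) \<bullet> rot u) * (w \<bullet> rot u) = 1"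
      using that unfolding dual_line_uv by simp_all
    then have "((Y - F) \<bullet> u) * (w \<bullet> u - q) = 0" by (simp add: algebra_simps)
    then have Yu: "(Y - F) \<bullet> u = 0" using wu by simp
    then have "(Y - F) \<bullet> rot u = 1 / (w \<bullet> rot u)" using Y assms(2) by (simp add: field_simps)
    then have "Y - F = ?X - F" using Yu X by (intro eq_uvI) simp_all
    then show ?thesis by (metis diff_add_cancel)
  qed
  moreover have "?X \<in> dual_line F w" "?X \<in> dual_line F (mirror w)"
    unfolding dual_line_uv X using assms(2) by simp_all
  ultimately show ?thesis using X(1) by blast
qed

lemma poncelet_opposite_sides:
  assumes pq: "poncelet_quadrilateral S P A B C D"
  shows "\<exists>X. affine hull {A, B} \<inter> affine hull {C, D} = {X} \<and> (X - F) \<bullet> u = 0"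
    and "\<exists>X. affine hull {B, C} \<inter> affine hull {D, A} = {X} \<and> (X - F) \<bullet> u = 0"
proof -
  obtain w z where q: "quad_meets A B C D w z" "mirror w \<noteq> w" "mirror z \<noteq> z"
    and hull: "affine hull {A, B} = dual_line F w" "affine hull {B, C} = dual_line F (mirror z)"
      "affine hull {C, D} = dual_line F (mirror w)" "affine hull {D, A} = dual_line F z"
    using poncelet_quad_meets[OF pq] .
  have "w \<bullet> rot u \<noteq> 0" "z \<bullet> rot u \<noteq> 0"
    using product_nonzero q(1) by (auto simp: quad_meets_def)
  then show "\<exists>X. affine hull {A, B} \<inter> affine hull {C, D} = {X} \<and> (X - F) \<bullet> u = 0"
    and "\<exists>X. affine hull {B, C} \<inter> affine hull {D, A} = {X} \<and> (X - F) \<bullet> u = 0"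
    using dual_line_mirror_inter[of w] dual_line_mirror_inter[of z] q(2,3)
    unfolding hull by (simp_all add: Int_commute)
qed

section \<open>Anticenters and centroids\<close>

definition center :: plane where "center = F + (q / \<mu>) *\<^sub>R u"

lemma midpoint_perp:
  assumes "A \<in> S" "B \<in> S"
  shows "(midpoint A B - center) \<bullet> (B - A) = 0"
proof -
  define x y where "x = A - center" and "y = B - center"
  have "norm x = norm y"
    using assms by (simp add: S_def x_def y_def center_def[symmetric] dist_norm norm_minus_commute)
  then have "x \<bullet> x = y \<bullet> y" by (simp add: norm_eq)
  moreover have "midpoint A B - center = (1 / 2) *\<^sub>R (x + y)"
    by (simp add: midpoint_def x_def y_def vec_eq_iff field_simps)
  moreover have "B - A = y - x" by (simp add: x_def y_def)
  ultimately show ?thesis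
    by (simp add: inner_add_left inner_diff_right inner_commute[of y x])
qed

text \<open>The midpoint of a chord is the foot of the perpendicular from the center of \<open>S\<close>.\<close>

lemma midpoint_chord:
  assumes w: "w \<in> W" and A: "A \<in> S" "A \<in> dual_line F w" and B: "B \<in> S" "B \<in> dual_line F w"
    and "A \<noteq> B"
  shows "(midpoint A B - center) \<bullet> g = (1 - (q / \<mu>) * (w \<bullet> u)) / 2"
proof -
  define M where "M = midpoint A B - center"
  have "M \<bullet> (B - A) = 0" using midpoint_perp A B by (simp add: M_def)
  moreover have "w \<bullet> (B - A) = 0"
    using A(2) B(2) unfolding dual_line_def inner_commute[of _ w] by (simp add: inner_diff_right)
  moreover have "B - A \<noteq> 0" using \<open>A \<noteq> B\<close> by simp
  ultimately obtain s t where st: "M = s *\<^sub>R rot (B - A)" "w = t *\<^sub>R rot (B - A)"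
    by (metis orthogonal_imp_scaled_rot)
  have "t \<noteq> 0" using st(2) dual_line_nonzero[OF A(2)] by auto
  then have M: "M = (s / t) *\<^sub>R w" using st by simp
  have "(midpoint A B - F) \<bullet> w = 1"
    using A(2) B(2) by (simp add: dual_line_def midpoint_def inner_diff_left inner_add_left algebra_simps)
  then have "M \<bullet> w = 1 - (q / \<mu>) * (w \<bullet> u)"
    by (simp add: M_def center_def inner_diff_left inner_add_left inner_commute[of u w])
  \<comment> \<open>\<open>M\<close> is a multiple of \<open>w\<close>, and \<open>w\<close>
    satisfies the equation of \<open>W\<close>.\<close>
  moreover have "M \<bullet> w = 2 * (M \<bullet> g)"
    using w unfolding M W_def by (simp add: inner_commute[of w g])
  ultimately show ?thesis by (simp add: M_def)
qed

text \<open>The vector from \<open>midpoint A B\<close> to this point is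
  \<open>midpoint C D - center\<close>, which is orthogonal to the chord \<open>CD\<close>; the
  other sides are alike.\<close>

lemma anticenter_eq:
  assumes S: "A \<in> S" "B \<in> S" "C \<in> S" "D \<in> S" and dist: "distinct [A, B, C, D]"
  shows "anticenter A B C D = midpoint A B + midpoint C D - center"
proof -
  define H where "H = midpoint A B + midpoint C D - center"
  define I where "I = perp_line (midpoint A B) (D - C) \<inter> perp_line (midpoint B C) (A - D) \<inter>
             perp_line (midpoint C D) (B - A) \<inter> perp_line (midpoint D A) (C - B)"
  have H2: "H = midpoint B C + midpoint D A - center"
    by (simp add: H_def midpoint_def algebra_simps)
  have "H - midpoint A B = midpoint C D - center" "H - midpoint C D = midpoint A B - center"
    by (simp_all add: H_def)
  moreover have "H - midpoint B C = midpoint D A - center" "H - midpoint D A = midpoint B C - center"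
    by (simp_all add: H2)
  ultimately have HI: "H \<in> I"
    using midpoint_perp S by (simp add: I_def perp_line_def)
  have "X = H" if "X \<in> I" for X
  proof (rule ccontr)
    \<comment> \<open>\<open>X - H\<close> would be orthogonal to both \<open>CD\<close> and
      \<open>DA\<close>, making \<open>A\<close>, \<open>C\<close>, \<open>D\<close>
      collinear.\<close>
    assume "X \<noteq> H"
    have "(X - midpoint A B) \<bullet> (D - C) = 0" "(H - midpoint A B) \<bullet> (D - C) = 0"
      "(X - midpoint B C) \<bullet> (A - D) = 0" "(H - midpoint B C) \<bullet> (A - D) = 0"
      using that HI by (simp_all add: I_def perp_line_def)
    then have "(X - H) \<bullet> (D - C) = 0" "(X - H) \<bullet> (A - D) = 0"
      by (simp_all add: inner_diff_left)
    then have "C \<bullet> (X - H) = D \<bullet> (X - H)" "A \<bullet> (X - H) = D \<bullet> (X - H)"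
      unfolding inner_commute[of _ "X - H"] by (simp_all add: inner_diff_right)
    then show False
      using sphere_line_at_most_two[of A _ R C D "X - H"] S dist \<open>X \<noteq> H\<close> unfolding S_def by auto
  qed
  then have I: "I = {H}" using HI by blast
  have "anticenter A B C D = (THE H'. I = {H'})" by (simp add: anticenter_def I_def)
  also have "\<dots> = H" unfolding I by simp
  finally show ?thesis by (simp add: H_def)
qed

text \<open>The coordinates of \<open>w\<close> and \<open>mirror w\<close> along \<open>u\<close>
  sum to \<open>2 * q\<close>, so \<open>w\<close> drops out when the formulas for the two midpoints
  are added.\<close>

lemma poncelet_anticenter:
  assumes pq: "poncelet_quadrilateral S P A B C D"
  shows "anticenter A B C D \<in> dual_line F g"
proof -
  obtain w z where q: "quad_meets A B C D w z" using poncelet_quad_meets[OF pq] .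
  have m: "meets A w z" "meets B w (mirror z)" "meets C (mirror w) (mirror z)" "meets D (mirror w) z"
    and S: "A \<in> S" "B \<in> S" "C \<in> S" "D \<in> S"
    using q by (simp_all add: quad_meets_def)
  have dist: "distinct [A, B, C, D]"
    using pq by (auto simp: poncelet_quadrilateral_def)
  have AB: "(midpoint A B - center) \<bullet> g = (1 - (q / \<mu>) * (w \<bullet> u)) / 2"
    using midpoint_chord[of w A B] meetsD m S dist by auto
  have CD: "(midpoint C D - center) \<bullet> g = (1 - (q / \<mu>) * (mirror w \<bullet> u)) / 2"
    using midpoint_chord[of "mirror w" C D] meetsD m S dist by auto
  have "(center - F) \<bullet> g = (q / \<mu>) * q" by (simp add: center_def inner_commute[of u])
  moreover have "anticenter A B C D - F
      = (midpoint A B - center) + (midpoint C D - center) + (center - F)"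
    unfolding anticenter_eq[OF S dist] by simp
  ultimately have "(anticenter A B C D - F) \<bullet> g = 1"
    using AB CD by (simp add: inner_add_left) (simp add: algebra_simps add_divide_distrib diff_divide_distrib)
  then show ?thesis by (simp add: dual_line_def)
qed

lemma poncelet_centroid:
  assumes pq: "poncelet_quadrilateral S P A B C D"
  shows "centroid A B C D = (1 / 2) *\<^sub>R (anticenter A B C D + center)"
proof -
  have "A \<in> S" "B \<in> S" "C \<in> S" "D \<in> S" "distinct [A, B, C, D]"
    using pq by (auto simp: poncelet_quadrilateral_def inscribed_def)
  then show ?thesis
    by (simp add: anticenter_eq centroid_def midpoint_def scaleR_add_right)
qed

section \<open>Existence of nondegenerate quadrilaterals\<close>

lemma W_bound:
  assumes "w \<in> W"
  shows "(w \<bullet> u - q)\<^sup>2 + (w \<bullet> rot u - h)\<^sup>2 = q\<^sup>2 + h\<^sup>2"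
  using W_uv[OF assms] by (simp add: power2_eq_square algebra_simps)

lemma ex_W:
  assumes "(a - h)\<^sup>2 < q\<^sup>2 + h\<^sup>2" "a \<noteq> 0"
  obtains w where "w \<in> W" "w \<bullet> rot u = a" "mirror w \<noteq> w"
proof -
  define e where "e = sqrt (q\<^sup>2 + h\<^sup>2 - (a - h)\<^sup>2)"
  have e: "e > 0" "e\<^sup>2 = q\<^sup>2 + h\<^sup>2 - (a - h)\<^sup>2" using assms(1) by (simp_all add: e_def)
  \<comment> \<open>The larger root of the equation of \<open>W\<close> at height \<open>a\<close>;
    \<open>e > 0\<close> puts it off the mirror axis.\<close>
  define w where "w = (q + e) *\<^sub>R u + a *\<^sub>R rot u"
  have w: "w \<bullet> u = q + e" "w \<bullet> rot u = a" by (simp_all add: w_def inner_add_left)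
  have "w \<noteq> 0" using w(2) assms(2) by auto
  then have "w \<in> W" using e(2) by (intro W_uvI) (simp_all add: w power2_eq_square algebra_simps)
  moreover have "mirror w \<noteq> w"
  proof
    assume "mirror w = w"
    then have "mirror w \<bullet> u = w \<bullet> u" by simp
    then show False using w(1) e(1) by simp
  qed
  ultimately show thesis using that w by blast
qed

text \<open>Coordinates on \<open>W\<close> along \<open>rot u\<close> range between
  \<open>h - r\<close> and \<open>h + r\<close>, with 0 strictly inside. The given pair may be equal
  or extremal; it is replaced by distinct interior values with the same product.\<close>

lemma ex_unequal_product:
  assumes W: "w \<in> W" "z \<in> W" "w \<noteq> z" and pr: "(w \<bullet> rot u) * (z \<bullet> rot u) = - \<mu>"
  obtains a b where "a * b = - \<mu>" "a \<noteq> b" "(a - h)\<^sup>2 < q\<^sup>2 + h\<^sup>2" "(b - h)\<^sup>2 < q\<^sup>2 + h\<^sup>2"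
proof -
  define r where "r = sqrt (q\<^sup>2 + h\<^sup>2)"
  have "h\<^sup>2 < q\<^sup>2 + h\<^sup>2" using q by simp
  then have hr: "\<bar>h\<bar> < r" unfolding r_def by (metis real_sqrt_abs real_sqrt_less_iff)
  have hr0: "0 < h + r" "0 < r - h" using hr by linarith+
  have r2: "r\<^sup>2 = q\<^sup>2 + h\<^sup>2" by (simp add: r_def)
  have sq: "(x - h)\<^sup>2 < q\<^sup>2 + h\<^sup>2 \<longleftrightarrow> h - r < x \<and> x < h + r" for x
    unfolding r2[symmetric] using hr abs_le_square_iff[of r "x - h"] by auto
  have bd: "\<bar>v \<bullet> rot u - h\<bar> \<le> r" if "v \<in> W" for v
  proof -
    have "(v \<bullet> rot u - h)\<^sup>2 \<le> r\<^sup>2" unfolding r2 W_bound[OF that, symmetric] by simp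
    then show ?thesis using abs_le_square_iff[of "v \<bullet> rot u - h" r] hr by simp
  qed
  \<comment> \<open>Equal coordinates make \<open>z\<close> the mirror image of \<open>w\<close>,
    which is then off the axis, where the bound is strict.\<close>
  have strict: "\<bar>w \<bullet> rot u - h\<bar> < r" if eq: "w \<bullet> rot u = z \<bullet> rot u"
  proof -
    have "z = mirror w" using W_eq_or_mirror[OF W(1,2) eq] W(3) by auto
    then have "w \<bullet> u - q \<noteq> 0" using W(3) by (auto simp: mirror_def)
    then have "(w \<bullet> rot u - h)\<^sup>2 < r\<^sup>2" unfolding r2 W_bound[OF W(1), symmetric] by simp
    then show ?thesis using abs_le_square_iff[of r "w \<bullet> rot u - h"] hr by simp
  qed
  define a0 b0 where "a0 = w \<bullet> rot u" and "b0 = z \<bullet> rot u"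
  have ab0: "a0 * b0 = - \<mu>" "\<bar>a0 - h\<bar> \<le> r" "\<bar>b0 - h\<bar> \<le> r" "a0 = b0 \<Longrightarrow> \<bar>a0 - h\<bar> < r"
    using pr bd W strict by (simp_all add: a0_def b0_def)
  consider "\<mu> > 0" | "\<mu> < 0" "a0 > 0" "b0 > 0" | "\<mu> < 0" "a0 < 0" "b0 < 0"
    using \<mu> ab0(1) zero_less_mult_iff[of a0 b0] by (cases "\<mu> > 0") auto
  then show thesis
  proof cases
    case 1
    \<comment> \<open>The factors will have opposite signs and so differ; this inequality leaves
      room for \<open>a\<close> above \<open>h - r\<close> with its partner below
      \<open>h + r\<close>.\<close>
    have "\<mu> < (h + r) * (r - h)" using \<mu>_less r2 by (simp add: power2_eq_square algebra_simps)
    then have "(h - r) * (h + r) < - \<mu>" by (simp add: algebra_simps)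
    then have "h - r < - \<mu> / (h + r)" by (simp only: pos_less_divide_eq[OF hr0(1)])
    then obtain a where a: "h - r < a" "a < - \<mu> / (h + r)" using dense by blast
    have "- \<mu> / (h + r) < 0" using 1 hr0(1) by (simp add: divide_neg_pos)
    then have a0: "a < 0" using a by simp
    have "a * (h + r) < - \<mu>" using a(2) by (simp only: pos_less_divide_eq[OF hr0(1)])
    then have b: "- \<mu> / a < h + r" by (simp only: neg_divide_less_eq[OF a0] mult.commute)
    have "- \<mu> / a > 0" using 1 a0 by (intro divide_neg_neg) simp_all
    then show thesis using that[of a "- \<mu> / a"] a a0 b sq hr by auto
  next
    case 2
    have "a0 \<le> h + r" "b0 \<le> h + r" "a0 = b0 \<Longrightarrow> a0 < h + r" using ab0 by auto
    then have "a0 * b0 < (h + r)\<^sup>2"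
      using mult_less_square[of "a0" "h + r" "b0"] 2 by simp
    then obtain a b where "0 < a" "a < h + r" "0 < b" "b < h + r" "a * b = - \<mu>" "a \<noteq> b"
      using ex_unequal_factors[of "- \<mu>" "h + r"] 2 hr0 ab0(1) by auto
    then show thesis using that[of a b] sq hr by auto
  next
    case 3
    have "- a0 \<le> r - h" "- b0 \<le> r - h" "a0 = b0 \<Longrightarrow> - a0 < r - h" using ab0 by auto
    then have "(- a0) * (- b0) < (r - h)\<^sup>2"
      using mult_less_square[of "- a0" "r - h" "- b0"] 3 by simp
    then obtain a b where "0 < a" "a < r - h" "0 < b" "b < r - h" "a * b = - \<mu>" "a \<noteq> b"
      using ex_unequal_factors[of "- \<mu>" "r - h"] 3 hr0 ab0(1) by auto
    then show thesis using that[of "- a" "- b"] sq hr by auto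
  qed
qed

text \<open>Unequal coordinates keep \<open>w'\<close> apart from \<open>z'\<close> and
  \<open>mirror z'\<close>, and interior ones allow lines that are not self-mirrored, so nothing
  degenerates.\<close>

lemma ex_poncelet_quadrilateral:
  assumes W: "w \<in> W" "z \<in> W" "w \<noteq> z" and pr: "(w \<bullet> rot u) * (z \<bullet> rot u) = - \<mu>"
  shows "poncelet_pair4 S P"
proof -
  obtain a b where ab: "a * b = - \<mu>" "a \<noteq> b" "(a - h)\<^sup>2 < q\<^sup>2 + h\<^sup>2" "(b - h)\<^sup>2 < q\<^sup>2 + h\<^sup>2"
    using ex_unequal_product[OF assms] .
  have "a \<noteq> 0" "b \<noteq> 0" using ab(1) \<mu> by auto
  obtain w' where w': "w' \<in> W" "w' \<bullet> rot u = a" "mirror w' \<noteq> w'" using ex_W[OF ab(3) \<open>a \<noteq> 0\<close>] .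
  obtain z' where z': "z' \<in> W" "z' \<bullet> rot u = b" "mirror z' \<noteq> z'" using ex_W[OF ab(4) \<open>b \<noteq> 0\<close>] .
  obtain A where A: "meets A w' z'" "A \<in> S"
    using ex_meets_of_product[OF w'(1) z'(1)] w'(2) z'(2) ab(1) by blast
  obtain B C D where "quad_meets A B C D w' z'" using ex_quad_meets[OF A] .
  moreover have "w' \<noteq> z'" "w' \<noteq> mirror z'" using w'(2) z'(2) ab(2) mirror_uv(2)[of z'] by auto
  ultimately show ?thesis
    using quad_meets_poncelet w'(3) z'(3) unfolding poncelet_pair4_def by blast
qed

lemma nonconvex_part_meets:
  assumes A: "A \<in> nonconvex_part P"
  obtains w z where "w \<noteq> z" "meets A w z"
proof -
  obtain w z where "w \<noteq> z" "w \<bullet> w = 2 * (g \<bullet> w)" "z \<bullet> z = 2 * (g \<bullet> z)"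
    "A \<in> dual_line F w" "A \<in> dual_line F z"
    using nonconvex_part_two_tangents[OF g_nonzero A[unfolded P_def]] .
  moreover from this have "w \<in> W" "z \<in> W" using dual_line_nonzero by (auto simp: W_def)
  ultimately show thesis using that meetsI by blast
qed

text \<open>Each degeneracy violates an assumption: \<open>w = mirror z\<close> puts
  \<open>B\<close> on \<open>P\<close>, while a self-mirrored \<open>w\<close> or \<open>z\<close>
  gives \<open>D = A\<close> or \<open>B = A\<close>.\<close>

lemma poncelet_from_point:
  assumes A: "A \<in> S" "A \<in> nonconvex_part P"
  shows "\<exists>B C D. poncelet_closed4 S P A B C D \<and>
      (B \<noteq> A \<and> D \<noteq> A \<and> B \<notin> P \<and> D \<notin> P \<longrightarrow> poncelet_quadrilateral S P A B C D)"
proof -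
  obtain w z where wz: "w \<noteq> z" "meets A w z" using nonconvex_part_meets[OF A(2)] .
  obtain B C D where q: "quad_meets A B C D w z" using ex_quad_meets[OF wz(2) A(1)] .
  have m: "meets B w (mirror z)" "meets D (mirror w) z" using q by (simp_all add: quad_meets_def)
  have "poncelet_quadrilateral S P A B C D" if "B \<noteq> A" "D \<noteq> A" "B \<notin> P" "D \<notin> P"
  proof (rule quad_meets_poncelet[OF q wz(1)])
    show "w \<noteq> mirror z" using m(1) that(3) meets_touching_mem_P by auto
    show "mirror w \<noteq> w" using m(2) that(2) wz(2) meets_unique by metis
    show "mirror z \<noteq> z" using m(1) that(1) wz(2) meets_unique by metis
  qed
  then show ?thesis using quad_meets_closed[OF q wz(1)] by blast
qed

end

section \<open>Focal coordinates of the given circle and directrix\<close>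

theorem theorem4p5:
  fixes E F L :: plane and R :: real and l P :: "plane set"
  assumes "R > 0" and "F \<noteq> E"
    and "affine hull {E, F} \<inter> polar E R F = {L}"
    and "is_line l" and "L \<in> l" and "F \<notin> l"
    and "P = parabola F l"
  shows
    "\<comment> \<open>(a)\<close>
     (\<forall>A B D s t.
        A \<in> sphere E R \<and> A \<in> nonconvex_part P \<and>
        s \<noteq> t \<and> tangent_to s P \<and> tangent_to t P \<and> A \<in> s \<and> A \<in> t \<and>
        second_intersection (sphere E R) s A B \<and> second_intersection (sphere E R) t A D
        \<longrightarrow> L \<in> affine hull {B, D})
     \<and>
     \<comment> \<open>(b)\<close>
     ((\<forall>A. A \<in> sphere E R \<and> A \<in> nonconvex_part P \<longrightarrow>
         (\<exists>B C D. poncelet_closed4 (sphere E R) P A B C D \<and>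
            (B \<noteq> A \<and> D \<noteq> A \<and> B \<notin> P \<and> D \<notin> P
               \<longrightarrow> poncelet_quadrilateral (sphere E R) P A B C D))) \<and>
      (sphere E R \<inter> nonconvex_part P \<noteq> {} \<longrightarrow> poncelet_pair4 (sphere E R) P))
     \<and>
     \<comment> \<open>(c)\<close>
     (\<forall>A B C D. poncelet_quadrilateral (sphere E R) P A B C D \<longrightarrow>
        affine hull {A, C} \<inter> affine hull {B, D} = {L})
     \<and>
     \<comment> \<open>(d)\<close>
     (\<forall>A B C D. poncelet_quadrilateral (sphere E R) P A B C D \<longrightarrow>
        (\<exists>X. affine hull {A, B} \<inter> affine hull {C, D} = {X} \<and> X \<in> perp_line F (F - E)) \<and>
        (\<exists>X. affine hull {B, C} \<inter> affine hull {D, A} = {X} \<and> X \<in> perp_line F (F - E)))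
     \<and>
     \<comment> \<open>(e)\<close>
     (\<forall>A B C D. poncelet_quadrilateral (sphere E R) P A B C D \<longrightarrow> anticenter A B C D \<in> l)
     \<and>
     \<comment> \<open>(f)\<close>
     ((\<exists>l'. is_line l' \<and> affine_parallel l l' \<and> l' \<noteq> l \<and>
         (\<forall>A B C D. poncelet_quadrilateral (sphere E R) P A B C D \<longrightarrow>
            centroid A B C D \<in> l')) \<and>
      (\<forall>p. l = {X. X $ 1 = - p} \<and> F = 0 \<longrightarrow>
         (\<forall>A B C D. poncelet_quadrilateral (sphere E R) P A B C D \<longrightarrow>
            centroid A B C D $ 1 = (E $ 1 - p) / 2)))"
proof -
  define \<delta> where "\<delta> = norm (E - F)"
  \<comment> \<open>The power of \<open>F\<close> with respect to the circle; \<open>L\<close> will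
    be at signed distance \<open>\<kappa> / \<delta>\<close> from \<open>F\<close> along
    \<open>u\<close>.\<close>
  define \<kappa> where "\<kappa> = \<delta>\<^sup>2 - R\<^sup>2"
  define u where "u = (1 / \<delta>) *\<^sub>R (E - F)"
  have \<delta>: "\<delta> > 0" using assms(2) by (simp add: \<delta>_def)
  have EF: "E = F + \<delta> *\<^sub>R u" using \<delta> by (simp add: u_def)
  have uu: "u \<bullet> u = 1"
  proof -
    have "(E - F) \<bullet> (E - F) = \<delta> * \<delta>" by (simp add: \<delta>_def dot_square_norm power2_eq_square)
    then show ?thesis using \<delta> by (simp add: u_def)
  qed
  have "L \<in> affine hull {E, F}" "L \<in> polar E R F" using assms(3) by blast+
  then obtain k s where ks: "L = k *\<^sub>R E + s *\<^sub>R F" "k + s = 1"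
    unfolding affine_hull_2 by auto
  have "k = 1 - s" using ks(2) by simp
  then have s: "L = E + s *\<^sub>R (F - E)"
    using ks(1) by (simp add: scaleR_left_diff_distrib scaleR_right_diff_distrib)
  have LF: "L = F + ((1 - s) * \<delta>) *\<^sub>R u" unfolding s EF by (simp add: algebra_simps)
  have "(s *\<^sub>R (F - E)) \<bullet> (F - E) = R\<^sup>2"
    using \<open>L \<in> polar E R F\<close> unfolding s polar_def by simp
  then have "s * \<delta>\<^sup>2 = R\<^sup>2" unfolding EF by (simp add: uu power2_eq_square mult_ac)
  then have \<kappa>_s: "(1 - s) * \<delta> = \<kappa> / \<delta>"
    using \<delta> by (simp add: \<kappa>_def field_simps power2_eq_square)
  \<comment> \<open>For \<open>F\<close> on the circle, \<open>L\<close> would be \<open>F\<close>;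
    but \<open>l\<close> contains \<open>L\<close> and not \<open>F\<close>.\<close>
  have "L \<noteq> F" using assms(5,6) by blast
  then have \<kappa>: "\<kappa> \<noteq> 0" using LF \<kappa>_s by auto
  obtain g where g: "g \<noteq> 0" "l = dual_line F g" using is_line_dual_lineE[OF assms(4,6)] .
  define q \<mu> where "q = \<delta> / \<kappa>" and "\<mu> = 1 / \<kappa>"
  have LF': "L = F + (1 / q) *\<^sub>R u" using LF \<kappa>_s by (simp add: q_def)
  interpret fc: focal_circle F u q "g \<bullet> rot u" \<mu> R
  proof
    show "R\<^sup>2 = (q / \<mu>)\<^sup>2 - 1 / \<mu>" using \<kappa> by (simp add: q_def \<mu>_def \<kappa>_def)
  qed (use uu \<delta> \<kappa> assms(1) in \<open>simp_all add: q_def \<mu>_def\<close>)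
  have q\<mu>: "q / \<mu> = \<delta>" using \<kappa> by (simp add: q_def \<mu>_def)
  \<comment> \<open>\<open>L\<close> on \<open>l\<close> fixes the \<open>u\<close>-coordinate of
    \<open>g\<close>; the other coordinate is the locale parameter \<open>h\<close>.\<close>
  have "(1 / q) * (u \<bullet> g) = 1" using assms(5) unfolding g(2) LF' by (simp add: dual_line_def)
  then have "g \<bullet> u = q" using fc.q by (simp add: inner_commute[of g] divide_eq_1_iff)
  then have gg: "fc.g = g" by (intro fc.eq_uvI) simp_all
  have E: "fc.center = E" unfolding fc.center_def q\<mu> by (rule EF[symmetric])
  have S: "sphere E R = fc.S" using E by (simp add: fc.S_def fc.center_def)
  have P: "P = fc.P" using assms(7) g(2) gg by (simp add: fc.P_def)
  have L: "L = fc.L" using LF' by (simp add: fc.L_def)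
  have l: "l = {X. X \<bullet> g = 1 + F \<bullet> g}" using g(2) by (simp add: dual_line_eq_hyperplane)
  have FE: "F - E = (- \<delta>) *\<^sub>R u" unfolding EF by simp
  have anti: "anticenter A B C D \<in> l" if "poncelet_quadrilateral fc.S fc.P A B C D" for A B C D
    using fc.poncelet_anticenter[OF that] gg g(2) by simp
  have cent: "centroid A B C D = (1 / 2) *\<^sub>R (anticenter A B C D + E)"
    if "poncelet_quadrilateral fc.S fc.P A B C D" for A B C D
    using fc.poncelet_centroid[OF that] E by simp

  have part_a: "L \<in> affine hull {B, D}"
    if A: "A \<in> fc.S" and st: "s \<noteq> t" "tangent_to s fc.P" "tangent_to t fc.P" "A \<in> s" "A \<in> t"
      and BD: "second_intersection fc.S s A B" "second_intersection fc.S t A D" for A B D s t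
  proof -
    obtain w where w: "w \<in> fc.W" "s = dual_line F w" using st(2) unfolding fc.tangent_iff by blast
    obtain z where z: "z \<in> fc.W" "t = dual_line F z" using st(3) unfolding fc.tangent_iff by blast
    have "w \<noteq> z" using st(1) w(2) z(2) by blast
    then show ?thesis
      using fc.L_on_diagonal[OF A w(1) z(1)] st(4,5) BD unfolding w(2) z(2) L by simp
  qed

  have part_b: "poncelet_pair4 fc.S fc.P" if ne: "fc.S \<inter> nonconvex_part fc.P \<noteq> {}"
  proof -
    obtain A where A: "A \<in> fc.S" "A \<in> nonconvex_part fc.P" using ne by blast
    obtain w z where wz: "w \<noteq> z" "fc.meets A w z" using fc.nonconvex_part_meets[OF A(2)] .
    then show ?thesis
      using fc.ex_poncelet_quadrilateral[of w z] fc.meetsD[OF wz(2)] fc.meets_mem_S_iff[OF wz(2)] A(1) by simp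
  qed

  have perp: "X \<in> perp_line F (F - E) \<longleftrightarrow> (X - F) \<bullet> u = 0" for X
    using \<delta> unfolding FE perp_line_def by simp

  \<comment> \<open>Translation by \<open>a\<close> carries \<open>l\<close> to the midpoints of
    \<open>E\<close> with points of \<open>l\<close>, because \<open>L\<close> is on
    \<open>l\<close>.\<close>
  define a where "a = (1 / 2) *\<^sub>R (E - L)"
  define l' where "l' = (\<lambda>X. a + X) ` l"
  have l': "l' = {X. X \<bullet> g = 1 + F \<bullet> g + a \<bullet> g}"
  proof (intro equalityI subsetI)
    fix X assume "X \<in> {X. X \<bullet> g = 1 + F \<bullet> g + a \<bullet> g}"
    then have "X - a \<in> l" unfolding l by (simp add: inner_diff_left)
    then show "X \<in> l'" unfolding l'_def by (intro image_eqI[of _ _ "X - a"]) simp_all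
  qed (auto simp: l'_def l inner_add_left)
  \<comment> \<open>Otherwise \<open>E\<close> would lie on \<open>l\<close>, forcing
    \<open>\<mu> = q\<^sup>2\<close>, that is, \<open>R = 0\<close>.\<close>
  have ag: "a \<bullet> g \<noteq> 0"
  proof
    assume "a \<bullet> g = 0"
    then have "E \<bullet> g = L \<bullet> g" by (simp add: a_def inner_diff_left)
    also have "\<dots> = 1 + F \<bullet> g" using assms(5) l by blast
    finally have "\<delta> * (u \<bullet> g) = 1" unfolding EF by (simp add: inner_add_left)
    then have "\<delta> * q = 1" using \<open>g \<bullet> u = q\<close> by (simp add: inner_commute)
    then have "\<mu> = q\<^sup>2" using q\<mu>[symmetric] fc.\<mu> by (simp add: power2_eq_square)
    then show False using fc.\<mu>_less by simp
  qed
  have "is_line l'" unfolding l' using is_line_hyperplane[OF g(1)] .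
  moreover have "affine_parallel l l'" unfolding affine_parallel_def l'_def by blast
  moreover have "l' \<noteq> l"
  proof
    assume "l' = l"
    then have "a + L \<in> l" using assms(5) l'_def by blast
    then show False using assms(5) ag unfolding l by (simp add: inner_add_left)
  qed
  moreover have "centroid A B C D \<in> l'" if "poncelet_quadrilateral fc.S fc.P A B C D" for A B C D
  proof -
    have "anticenter A B C D \<bullet> g = 1 + F \<bullet> g" "L \<bullet> g = 1 + F \<bullet> g"
      using anti[OF that] assms(5) unfolding l by simp_all
    then show ?thesis
      unfolding l' cent[OF that] a_def by (simp add: inner_add_left inner_diff_left field_simps)
  qed
  ultimately have part_f: "\<exists>l'. is_line l' \<and> affine_parallel l l' \<and> l' \<noteq> l \<and>
      (\<forall>A B C D. poncelet_quadrilateral fc.S fc.P A B C D \<longrightarrow> centroid A B C D \<in> l')" by blast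
  have part_f_coord: "centroid A B C D $ 1 = (E $ 1 - p) / 2"
    if "l = {X. X $ 1 = - p}" "poncelet_quadrilateral fc.S fc.P A B C D" for p A B C D
    using anti[OF that(2)] unfolding that(1) cent[OF that(2)] by simp

  show ?thesis
    unfolding S P
  proof (intro conjI)
    show "\<forall>A B C D. poncelet_quadrilateral fc.S fc.P A B C D \<longrightarrow>
        affine hull {A, C} \<inter> affine hull {B, D} = {L}"
      using fc.poncelet_diagonals L by simp
    show "\<forall>A B C D. poncelet_quadrilateral fc.S fc.P A B C D \<longrightarrow>
        (\<exists>X. affine hull {A, B} \<inter> affine hull {C, D} = {X} \<and> X \<in> perp_line F (F - E)) \<and>
        (\<exists>X. affine hull {B, C} \<inter> affine hull {D, A} = {X} \<and> X \<in> perp_line F (F - E))"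
      unfolding perp using fc.poncelet_opposite_sides by simp
    show "\<forall>A B D s t. A \<in> fc.S \<and> A \<in> nonconvex_part fc.P \<and>
        s \<noteq> t \<and> tangent_to s fc.P \<and> tangent_to t fc.P \<and> A \<in> s \<and> A \<in> t \<and>
        second_intersection fc.S s A B \<and> second_intersection fc.S t A D
        \<longrightarrow> L \<in> affine hull {B, D}"
      by (intro allI impI, elim conjE, rule part_a)
    show "\<forall>A. A \<in> fc.S \<and> A \<in> nonconvex_part fc.P \<longrightarrow>
        (\<exists>B C D. poncelet_closed4 fc.S fc.P A B C D \<and>
          (B \<noteq> A \<and> D \<noteq> A \<and> B \<notin> fc.P \<and> D \<notin> fc.P
            \<longrightarrow> poncelet_quadrilateral fc.S fc.P A B C D))"
      by (intro allI impI, elim conjE, rule fc.poncelet_from_point)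
    show "\<exists>l'. is_line l' \<and> affine_parallel l l' \<and> l' \<noteq> l \<and>
        (\<forall>A B C D. poncelet_quadrilateral fc.S fc.P A B C D \<longrightarrow> centroid A B C D \<in> l')"
      by (rule part_f)
  qed (use part_b anti part_f_coord in simp_all)
qed

end
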